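(* Let $T$ and $\hat T$ be the exact and hybrid random-scan Gibbs kernels on $\mathsf X=\mathsf X_1\times\cdots\times\mathsf X_n$ targeting $\Pi$ (defined in the context). Suppose that there exists a constant $C\in[0,1]$ such that $\|Q_{i,y}\|_{\Pi_{i,y}}\le C$ for $i=1,\dots,n$ and $M_{-i}$-a.e. $y\in\mathsf X_{-i}$. Then $$(1-C)(1-\|T\|_\Pi)\le 1-\|\hat T\|_\Pi\le(1+C)(1-\|T\|_\Pi).$$ If, furthermore, $Q_{i,y}$ is positive semi-definite for $i=1,\dots,n$ and $M_{-i}$-a.e. $y\in\mathsf X_{-i}$, then $$1-\|\hat T\|_\Pi\le 1-\|T\|_\Pi.$$
   Context: $L^2$ conventions. For a probability space $(\mathsf Y,\mathcal F,\omega)$, $L^2(\omega)$ is the real Hilbert space of square-integrable functions (modulo a.e. equality) with inner product $\langle f,g\rangle_\omega=\int fg\,d\omega$ and norm $\|\cdot\|_\omega$; $L_0^2(\omega)=\{f\in L^2(\omega):\int f\,d\omega=0\}$. A Markov transition kernel (Mtk) $K$ on $\mathsf Y$ reversible with respect to $\omega$ acts as a self-adjoint operator on $L_0^2(\omega)$ by $Kf(y)=\int K(y,dy')f(y')$. Its norm $\|K\|_\omega=\sup_{f\in L_0^2(\omega)\setminus\{0\}}\|Kf\|_\omega/\|f\|_\omega\in[0,1]$ is the operator norm on $L_0^2(\omega)$. $K$ is positive semi-definite if $\langle f,Kf\rangle_\omega\ge0$ for all $f\in L_0^2(\omega)$. Gibbs setting. $(\mathsf X,\mathcal B)$ is the product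 of Polish spaces $\mathsf X_1,\dots,\mathsf X_n$ with Borel $\sigma$-algebras $\mathcal B_1,\dots,\mathcal B_n$, and $\Pi$ is a probability measure on $(\mathsf X,\mathcal B)$. For $x\in\mathsf X$, $x_{-i}$ is $x$ with the $i$th component removed, $\mathsf X_{-i}=\{x_{-i}:x\in\mathsf X\}$. For $X\sim\Pi$, $M_{-i}$ is the distribution of $X_{-i}$ and $\Pi_{i,y}$ is the conditional distribution of $X_i$ given $X_{-i}=y$. For each $i$ and $y\in\mathsf X_{-i}$, $Q_{i,y}:\mathsf X_i\times\mathcal B_i\to[0,1]$ is an Mtk reversible with respect to $\Pi_{i,y}$, and for every $i$ and $A\in\mathcal B_i$ the map $x\mapsto Q_{i,x_{-i}}(x_i,A)$ is measurable. Let $p_1,\dots,p_n\ge0$ with $\sum_i p_i=1$, and let $\delta$ denote a point mass. Define $$T(x,dx')=\sum_{i=1}^n p_i\,\Pi_{i,x_{-i}}(dx_i')\,\delta_{x_{-i}}(dx_{-i}'),\qquad \hat T(x,dx')=\sum_{i=1}^n p_i\,Q_{i,x_{-i}}(x_i,dx_i')\,\delta_{x_{-i}}(dx_{-i}').$$ Both are reversible with respect to $\Pi$. *)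

theory Defs
  imports "HOL-Probability.Probability"
begin

section \<open>Markov kernels as operators on mean-zero square-integrable functions\<close>

text \<open>Elements of $L^2$ are represented by measurable, square-integrable functions; for a
  kernel reversible with respect to \<open>\<omega>\<close>, the notions below do not depend on the representative of an
  almost-everywhere class.\<close>

definition L2 :: "'b measure \<Rightarrow> ('b \<Rightarrow> real) set" where
  "L2 \<omega> = {f \<in> borel_measurable \<omega>. integrable \<omega> (\<lambda>y. (f y)\<^sup>2)}"

definition L2_0 :: "'b measure \<Rightarrow> ('b \<Rightarrow> real) set" where
  "L2_0 \<omega> = {f \<in> L2 \<omega>. (\<integral>y. f y \<partial>\<omega>) = 0}"

definition l2_inner :: "'b measure \<Rightarrow> ('b \<Rightarrow> real) \<Rightarrow> ('b \<Rightarrow> real) \<Rightarrow> real" where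
  "l2_inner \<omega> f g = (\<integral>y. f y * g y \<partial>\<omega>)"

definition l2_norm :: "'b measure \<Rightarrow> ('b \<Rightarrow> real) \<Rightarrow> real" where
  "l2_norm \<omega> f = sqrt (l2_inner \<omega> f f)"

definition markov_kernel :: "'b measure \<Rightarrow> ('b \<Rightarrow> 'b measure) \<Rightarrow> bool" where
  "markov_kernel Y K \<longleftrightarrow> K \<in> Y \<rightarrow>\<^sub>M prob_algebra Y"

definition reversible :: "'b measure \<Rightarrow> ('b \<Rightarrow> 'b measure) \<Rightarrow> bool" where
  "reversible \<omega> K \<longleftrightarrow> (\<forall>A\<in>sets \<omega>. \<forall>B\<in>sets \<omega>.
     (\<integral>\<^sup>+y\<in>A. emeasure (K y) B \<partial>\<omega>) = (\<integral>\<^sup>+y\<in>B. emeasure (K y) A \<partial>\<omega>))"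

definition kernel_op :: "('b \<Rightarrow> 'b measure) \<Rightarrow> ('b \<Rightarrow> real) \<Rightarrow> 'b \<Rightarrow> real" where
  "kernel_op K f y = (\<integral>y'. f y' \<partial>K y)"

text \<open>The element 0 is inserted so that the norm is 0 when $L_0^2(\omega) = \{0\}$, where the supremum
  of the empty set would otherwise be unspecified.\<close>

definition kernel_norm :: "'b measure \<Rightarrow> ('b \<Rightarrow> 'b measure) \<Rightarrow> real" where
  "kernel_norm \<omega> K = Sup (insert 0
     {l2_norm \<omega> (kernel_op K f) / l2_norm \<omega> f | f. f \<in> L2_0 \<omega> \<and> \<not> (AE y in \<omega>. f y = 0)})"

definition pos_semidef :: "'b measure \<Rightarrow> ('b \<Rightarrow> 'b measure) \<Rightarrow> bool" where
  "pos_semidef \<omega> K \<longleftrightarrow> (\<forall>f\<in>L2_0 \<omega>. 0 \<le> l2_inner \<omega> f (kernel_op K f))"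

section \<open>Products of Polish spaces\<close>

text \<open>The factors are topologies on subsets of one type \<open>'a\<close>, so that they may differ from each other;
  points of the product are extensional functions on the index set.\<close>

definition polish :: "'a topology \<Rightarrow> bool" where
  "polish X \<longleftrightarrow> completely_metrizable_space X \<and> separable_space X"

definition borel_of :: "'a topology \<Rightarrow> 'a measure" where
  "borel_of X = sigma (topspace X) {U. openin X U}"

definition full_space :: "nat \<Rightarrow> (nat \<Rightarrow> 'a topology) \<Rightarrow> (nat \<Rightarrow> 'a) measure" where
  "full_space n X = (\<Pi>\<^sub>M j\<in>{1..n}. borel_of (X j))"

definition space_drop :: "nat \<Rightarrow> (nat \<Rightarrow> 'a topology) \<Rightarrow> nat \<Rightarrow> (nat \<Rightarrow> 'a) measure" where
  "space_drop n X i = (\<Pi>\<^sub>M j\<in>{1..n} - {i}. borel_of (X j))"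

definition drop_coord :: "nat \<Rightarrow> nat \<Rightarrow> (nat \<Rightarrow> 'a) \<Rightarrow> nat \<Rightarrow> 'a" where
  "drop_coord n i x = restrict x ({1..n} - {i})"

definition marginal_drop ::
    "nat \<Rightarrow> (nat \<Rightarrow> 'a topology) \<Rightarrow> (nat \<Rightarrow> 'a) measure \<Rightarrow> nat \<Rightarrow> (nat \<Rightarrow> 'a) measure" where
  "marginal_drop n X \<pi> i = distr \<pi> (space_drop n X i) (drop_coord n i)"

text \<open>\<open>\<kappa>\<close> is a regular version of the conditional distribution of the \<open>i\<close>th coordinate given the
  others under \<open>\<pi>\<close>.\<close>

definition cond_dist ::
    "nat \<Rightarrow> (nat \<Rightarrow> 'a topology) \<Rightarrow> (nat \<Rightarrow> 'a) measure \<Rightarrow> nat \<Rightarrow> ((nat \<Rightarrow> 'a) \<Rightarrow> 'a measure) \<Rightarrow> bool" where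
  "cond_dist n X \<pi> i \<kappa> \<longleftrightarrow>
     \<kappa> \<in> space_drop n X i \<rightarrow>\<^sub>M prob_algebra (borel_of (X i)) \<and>
     (\<forall>A\<in>sets (borel_of (X i)). \<forall>B\<in>sets (space_drop n X i).
        emeasure \<pi> {x \<in> space \<pi>. x i \<in> A \<and> drop_coord n i x \<in> B}
          = (\<integral>\<^sup>+y\<in>B. emeasure (\<kappa> y) A \<partial>marginal_drop n X \<pi> i))"

section \<open>Random-scan Gibbs kernels\<close>

text \<open>The measure $R(x_i, dx_i')\,\delta_{x_{-i}}(dx_{-i}')$: coordinate \<open>i\<close> is resampled from the
  distribution \<open>\<nu>\<close> and the others stay put.\<close>

definition update_coord ::
    "nat \<Rightarrow> (nat \<Rightarrow> 'a topology) \<Rightarrow> nat \<Rightarrow> (nat \<Rightarrow> 'a) \<Rightarrow> 'a measure \<Rightarrow> (nat \<Rightarrow> 'a) measure" where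
  "update_coord n X i x \<nu> = distr \<nu> (full_space n X) (\<lambda>u. x(i := u))"

definition random_scan ::
    "nat \<Rightarrow> (nat \<Rightarrow> 'a topology) \<Rightarrow> (nat \<Rightarrow> real) \<Rightarrow> (nat \<Rightarrow> (nat \<Rightarrow> 'a) \<Rightarrow> 'a \<Rightarrow> 'a measure)
      \<Rightarrow> (nat \<Rightarrow> 'a) \<Rightarrow> (nat \<Rightarrow> 'a) measure" where
  "random_scan n X p R x = measure_of (space (full_space n X)) (sets (full_space n X))
     (\<lambda>A. \<Sum>i=1..n. ennreal (p i) * emeasure (update_coord n X i x (R i (drop_coord n i x) (x i))) A)"

definition hybrid_gibbs ::
    "nat \<Rightarrow> (nat \<Rightarrow> 'a topology) \<Rightarrow> (nat \<Rightarrow> real) \<Rightarrow> (nat \<Rightarrow> (nat \<Rightarrow> 'a) \<Rightarrow> 'a \<Rightarrow> 'a measure)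
      \<Rightarrow> (nat \<Rightarrow> 'a) \<Rightarrow> (nat \<Rightarrow> 'a) measure" where
  "hybrid_gibbs n X p Q = random_scan n X p Q"

definition exact_gibbs ::
    "nat \<Rightarrow> (nat \<Rightarrow> 'a topology) \<Rightarrow> (nat \<Rightarrow> real) \<Rightarrow> (nat \<Rightarrow> (nat \<Rightarrow> 'a) \<Rightarrow> 'a measure)
      \<Rightarrow> (nat \<Rightarrow> 'a) \<Rightarrow> (nat \<Rightarrow> 'a) measure" where
  "exact_gibbs n X p \<pi>c = random_scan n X p (\<lambda>i y _. \<pi>c i y)"

lemma sets_random_scan [simp]: "sets (random_scan n X p R x) = sets (full_space n X)"
  by (simp add: random_scan_def)

text \<open>The set function in the definition of \<open>random_scan\<close> is countably additive, so it is the
  measure of the kernel.\<close>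

lemma emeasure_random_scan:
  assumes "A \<in> sets (full_space n X)"
  shows "emeasure (random_scan n X p R x) A =
    (\<Sum>i=1..n. ennreal (p i) * emeasure (update_coord n X i x (R i (drop_coord n i x) (x i))) A)"
unfolding random_scan_def
proof (rule emeasure_measure_of_sigma)
  let ?m = "\<lambda>i. update_coord n X i x (R i (drop_coord n i x) (x i))"
  let ?\<mu> = "\<lambda>A. \<Sum>i=1..n. ennreal (p i) * emeasure (?m i) A"
  have sets_m: "sets (?m i) = sets (full_space n X)" for i
    by (simp add: update_coord_def)
  show "countably_additive (sets (full_space n X)) ?\<mu>"
  proof (rule countably_additiveI)
    fix F :: "nat \<Rightarrow> (nat \<Rightarrow> 'a) set"
    assume F: "range F \<subseteq> sets (full_space n X)" "disjoint_family F"
    have "(\<Sum>k. ?\<mu> (F k)) = (\<Sum>i=1..n. \<Sum>k. ennreal (p i) * emeasure (?m i) (F k))"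
      by (rule suminf_sum) simp
    also have "\<dots> = ?\<mu> (\<Union>k. F k)"
      using F by (auto intro!: sum.cong simp: sets_m suminf_emeasure)
    finally show "(\<Sum>k. ?\<mu> (F k)) = ?\<mu> (\<Union>k. F k)" .
  qed
qed (use assms in \<open>auto simp: positive_def sets.sigma_algebra_axioms\<close>)

lemma emeasure_update_coord:
  assumes "i \<in> {1..n}" "x \<in> space (full_space n X)" "sets \<nu> = sets (borel_of (X i))"
    and "A \<in> sets (full_space n X)"
  shows "emeasure (update_coord n X i x \<nu>) A = emeasure \<nu> {u \<in> space \<nu>. x(i := u) \<in> A}"
proof -
  have "(\<lambda>u. x(i := u)) \<in> borel_of (X i) \<rightarrow>\<^sub>M full_space n X"
    unfolding full_space_def
    by (rule measurable_fun_upd[where J="{1..n}"])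
      (use assms(1,2) in \<open>auto simp: full_space_def\<close>)
  then have "(\<lambda>u. x(i := u)) \<in> \<nu> \<rightarrow>\<^sub>M full_space n X"
    using assms(3) by (simp cong: measurable_cong_sets)
  then show ?thesis
    unfolding update_coord_def
    by (subst emeasure_distr) (use assms(4) in \<open>auto intro!: arg_cong[where f="emeasure \<nu>"]\<close>)
qed

end

theory Submission
  imports Defs
begin

text \<open>For a reversible kernel $K$ and $f \in L^2(\omega)$ the energy
  $\int\int (f(x) - f(y))^2\,K(x,dy)\,\omega(dx)$ equals $2(\|f\|^2 - \langle f, Kf\rangle)$. It is
  invariant under $f \mapsto f + c$, additive over mixtures of kernels, and disintegrates over the
  fibers $\{x : x_{-i} = y\}$ for a kernel that moves only coordinate $i$. On each fiber the energies of
  $Q_{i,y}$ and of the exact update by $\Pi_{i,y}$ differ by a factor in $[1 - C, 1 + C]$ (at most 1 when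
  $Q_{i,y}$ is positive semi-definite), so the same comparison holds for $\hat T$ and $T$. By
  self-adjointness the norms are the suprema of the absolute quadratic forms; no absolute value is
  needed for $T$, which is positive semi-definite because its energy is at most $2\|f\|^2$.\<close>

section \<open>Reversible kernels\<close>

text \<open>The obstacle is that the sections of a mean-zero f along the fibers need not have mean
  zero under \<Pi>_{i,y}, so the norm of Q_{i,y} says nothing about them directly. Since the energy
  ignores constants, each section can be centered separately. On a centered g the exact update is
  the zero operator, with energy 2 \<parallel>g\<parallel>^2, while |<g, Q g>| \<le> C
  \<parallel>g\<parallel>^2; this is where 1 - C and 1 + C come from.

  The two sides of the result use the comparison differently. The upper bound on the hybrid gap uses
  only the upper factor: every form of the exact kernel is bounded through the hybrid norm, and
  being nonnegative it needs no second estimate. The lower bound on the hybrid gap uses both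
  factors: 1 - C bounds the hybrid form from above, and 1 + C bounds it from below, because the
  hybrid kernel may have negative spectrum and its norm sees absolute values.\<close>

lemma integrable_bind:
  fixes h :: "'b \<Rightarrow> real"
  assumes N: "N \<in> M \<rightarrow>\<^sub>M subprob_algebra B" and h: "integrable (M \<bind> N) h"
    and ne: "space M \<noteq> {}"
  shows "AE x in M. integrable (N x) h"
    and "integral\<^sup>L (M \<bind> N) h = (\<integral>x. integral\<^sup>L (N x) h \<partial>M)"
proof -
  note [measurable] = N
  have sets_bind: "sets (M \<bind> N) = sets B"
    by (rule sets_bind[OF sets_kernel[OF N] ne])
  have hB[measurable]: "h \<in> borel_measurable B"
    using borel_measurable_integrable[OF h] by (simp cong: measurable_cong_sets add: sets_bind)
  have hN: "h \<in> borel_measurable (N x)" if "x \<in> space M" for x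
    using hB sets_kernel[OF N that] by (simp cong: measurable_cong_sets)
  let ?P = "\<lambda>x. \<integral>\<^sup>+y. ennreal (h y) \<partial>N x"
  let ?M = "\<lambda>x. \<integral>\<^sup>+y. ennreal (- h y) \<partial>N x"
  have eq: "(\<integral>\<^sup>+y. ennreal (h y) \<partial>(M \<bind> N)) = (\<integral>\<^sup>+x. ?P x \<partial>M)"
    "(\<integral>\<^sup>+y. ennreal (- h y) \<partial>(M \<bind> N)) = (\<integral>\<^sup>+x. ?M x \<partial>M)"
    by (rule nn_integral_bind[OF _ N]; measurable)+
  have meas: "?P \<in> borel_measurable M" "?M \<in> borel_measurable M"
    by measurable
  have fin: "(\<integral>\<^sup>+x. ?P x \<partial>M) \<noteq> \<infinity>" "(\<integral>\<^sup>+x. ?M x \<partial>M) \<noteq> \<infinity>"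
    using h unfolding real_integrable_def eq by auto
  have AE: "AE x in M. ?P x \<noteq> \<infinity>" "AE x in M. ?M x \<noteq> \<infinity>"
    using nn_integral_PInf_AE[OF meas(1) fin(1)] nn_integral_PInf_AE[OF meas(2) fin(2)] by auto
  show int: "AE x in M. integrable (N x) h"
    using AE AE_space by eventually_elim (auto simp: real_integrable_def hN)
  \<comment> \<open>\<open>enn2real\<close> sends \<infinity> to 0. By \<open>AE\<close> this
    affects only a null set, so both integrals keep their values while the integrands become
    real.\<close>
  have enn: "(\<integral>\<^sup>+x. ennreal (enn2real (?P x)) \<partial>M) = (\<integral>\<^sup>+x. ?P x \<partial>M)"
    "(\<integral>\<^sup>+x. ennreal (enn2real (?M x)) \<partial>M) = (\<integral>\<^sup>+x. ?M x \<partial>M)"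
    using AE by (auto intro!: nn_integral_cong_AE simp: less_top)
  have intP: "integrable M (\<lambda>x. enn2real (?P x))" "integrable M (\<lambda>x. enn2real (?M x))"
    using fin meas by (auto intro!: integrableI_nonneg simp: enn less_top)
  have "(\<integral>x. integral\<^sup>L (N x) h \<partial>M) = (\<integral>x. enn2real (?P x) - enn2real (?M x) \<partial>M)"
    using int meas
    by (intro integral_cong_AE)
       (auto elim!: eventually_mono simp: real_lebesgue_integral_def intro!: measurable_compose[OF N integral_measurable_subprob_algebra])
  also have "\<dots> = enn2real (\<integral>\<^sup>+x. ?P x \<partial>M) - enn2real (\<integral>\<^sup>+x. ?M x \<partial>M)"
    using meas by (simp add: intP integral_eq_nn_integral enn)
  finally show "integral\<^sup>L (M \<bind> N) h = (\<integral>x. integral\<^sup>L (N x) h \<partial>M)"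
    using h by (simp add: real_lebesgue_integral_def eq)
qed

section \<open>Square-integrable functions and their inner product\<close>

lemma L2_integrable_mult:
  assumes "f \<in> L2 \<omega>" "g \<in> L2 \<omega>"
  shows "integrable \<omega> (\<lambda>x. f x * g x)"
proof (rule Bochner_Integration.integrable_bound)
  show "integrable \<omega> (\<lambda>x. (f x)\<^sup>2 + (g x)\<^sup>2)"
    using assms by (auto simp: L2_def)
  show "(\<lambda>x. f x * g x) \<in> borel_measurable \<omega>"
    using assms by (auto simp: L2_def)
  have "\<bar>a * b\<bar> \<le> a\<^sup>2 + b\<^sup>2" for a b :: real
  proof -
    have "2 * (\<bar>a\<bar> * \<bar>b\<bar>) \<le> a\<^sup>2 + b\<^sup>2"
      using sum_squares_bound[of "\<bar>a\<bar>" "\<bar>b\<bar>"] by (simp add: mult.assoc)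
    then show ?thesis using abs_ge_zero[of "a * b"] unfolding abs_mult by linarith
  qed
  then show "AE x in \<omega>. norm (f x * g x) \<le> norm ((f x)\<^sup>2 + (g x)\<^sup>2)"
    by (auto simp: abs_of_nonneg)
qed

lemma L2_add: "f \<in> L2 \<omega> \<Longrightarrow> g \<in> L2 \<omega> \<Longrightarrow> (\<lambda>x. f x + g x) \<in> L2 \<omega>"
  using L2_integrable_mult[of f \<omega> g] by (auto simp: L2_def power2_sum mult.assoc)

lemma L2_cmult: "f \<in> L2 \<omega> \<Longrightarrow> (\<lambda>x. c * f x) \<in> L2 \<omega>"
  by (auto simp: L2_def power_mult_distrib)

lemma (in finite_measure) L2_const: "(\<lambda>x. c) \<in> L2 M"
  by (simp add: L2_def)

lemma (in finite_measure) L2_integrable: "f \<in> L2 M \<Longrightarrow> integrable M f"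
  using L2_integrable_mult[OF _ L2_const, of f 1] by simp

lemma l2_inner_self_nonneg: "0 \<le> l2_inner \<omega> f f"
  by (simp add: l2_inner_def)

lemma l2_norm_power2: "(l2_norm \<omega> f)\<^sup>2 = l2_inner \<omega> f f"
  by (simp add: l2_norm_def l2_inner_self_nonneg)

lemma l2_norm_nonneg: "0 \<le> l2_norm \<omega> f"
  by (simp add: l2_norm_def l2_inner_self_nonneg)

lemma l2_inner_commute: "l2_inner \<omega> f g = l2_inner \<omega> g f"
  by (simp add: l2_inner_def mult.commute)

lemma l2_inner_add_right:
  "f \<in> L2 \<omega> \<Longrightarrow> g \<in> L2 \<omega> \<Longrightarrow> h \<in> L2 \<omega> \<Longrightarrow> l2_inner \<omega> f (\<lambda>x. g x + h x) = l2_inner \<omega> f g + l2_inner \<omega> f h"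
  by (simp add: l2_inner_def distrib_left L2_integrable_mult)

lemma l2_inner_cmult_right: "l2_inner \<omega> f (\<lambda>x. c * g x) = c * l2_inner \<omega> f g"
  by (simp add: l2_inner_def mult.left_commute)

lemma l2_inner_add_left:
  "f \<in> L2 \<omega> \<Longrightarrow> g \<in> L2 \<omega> \<Longrightarrow> h \<in> L2 \<omega> \<Longrightarrow> l2_inner \<omega> (\<lambda>x. g x + h x) f = l2_inner \<omega> g f + l2_inner \<omega> h f"
  by (metis l2_inner_add_right l2_inner_commute)

lemma l2_inner_cmult_left: "l2_inner \<omega> (\<lambda>x. c * g x) f = c * l2_inner \<omega> g f"
  by (metis l2_inner_cmult_right l2_inner_commute)

lemma l2_norm_eq_0_iff:
  assumes "f \<in> L2 \<omega>"
  shows "l2_norm \<omega> f = 0 \<longleftrightarrow> (AE x in \<omega>. f x = 0)"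
  using assms by (simp add: l2_norm_def l2_inner_def L2_def power2_eq_square[symmetric] integral_nonneg_eq_0_iff_AE)

text \<open>The polynomial t \<mapsto> \<parallel>f + t g\<parallel>^2 is nonnegative; if g has
  positive norm, its value at the minimizer t = - b / c gives the inequality.\<close>

lemma l2_Cauchy_Schwarz:
  assumes f: "f \<in> L2 \<omega>" and g: "g \<in> L2 \<omega>"
  shows "\<bar>l2_inner \<omega> f g\<bar> \<le> l2_norm \<omega> f * l2_norm \<omega> g"
proof -
  let ?a = "l2_inner \<omega> f f" and ?b = "l2_inner \<omega> f g" and ?c = "l2_inner \<omega> g g"
  have *: "0 \<le> ?a + 2 * t * ?b + t\<^sup>2 * ?c" for t
  proof -
    have "l2_inner \<omega> (\<lambda>x. f x + t * g x) (\<lambda>x. f x + t * g x) = ?a + 2 * t * ?b + t\<^sup>2 * ?c"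
      using f g
      by (simp add: l2_inner_add_left l2_inner_add_right L2_add L2_cmult l2_inner_cmult_left
          l2_inner_cmult_right l2_inner_commute[of \<omega> g f] power2_eq_square algebra_simps)
    then show ?thesis by (metis l2_inner_self_nonneg)
  qed
  have "?b\<^sup>2 \<le> ?a * ?c"
  proof (cases "?c = 0")
    case True
    have "?b = 0"
    proof (rule ccontr)
      assume "?b \<noteq> 0"
      \<comment> \<open>For c = 0 the polynomial is affine in t, and at this point it takes the
        value -1.\<close>
      then show False using *[of "- (?a + 1) / (2 * ?b)"] True by (simp add: field_simps)
    qed
    then show ?thesis using True by simp
  next
    case False
    then have c: "?c > 0" using l2_inner_self_nonneg[of \<omega> g] by simp
    have "0 \<le> ?a - ?b\<^sup>2 / ?c"
      using *[of "- ?b / ?c"] c by (simp add: field_simps power2_eq_square)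
    then show ?thesis using c by (simp add: field_simps)
  qed
  then have "\<bar>?b\<bar> \<le> sqrt (?a * ?c)"
    by (metis real_sqrt_abs real_sqrt_le_iff)
  then show ?thesis by (simp add: l2_norm_def real_sqrt_mult)
qed

text \<open>Twice the Dirichlet form of \<open>K\<close>. With values in \<open>ennreal\<close> it
  can be split over mixtures and fibers before any integrability is known.\<close>

definition energy :: "'b measure \<Rightarrow> ('b \<Rightarrow> 'b measure) \<Rightarrow> ('b \<Rightarrow> real) \<Rightarrow> ennreal" where
  "energy \<omega> K f = (\<integral>\<^sup>+x. \<integral>\<^sup>+y. ennreal ((f x - f y)\<^sup>2) \<partial>K x \<partial>\<omega>)"

text \<open>Law of two consecutive states of the chain started from \<omega>. Inner products with
  \<open>kernel_op K\<close> become integrals over this single measure, and reversibility becomes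
  its invariance under swapping the two states.\<close>

definition joint :: "'b measure \<Rightarrow> ('b \<Rightarrow> 'b measure) \<Rightarrow> ('b \<times> 'b) measure" where
  "joint \<omega> K = \<omega> \<bind> (\<lambda>x. distr (K x) (\<omega> \<Otimes>\<^sub>M \<omega>) (Pair x))"

section \<open>Reversible kernels as self-adjoint contractions\<close>

locale reversible_kernel = prob_space \<omega> for \<omega> :: "'b measure" +
  fixes K :: "'b \<Rightarrow> 'b measure"
  assumes kernel: "markov_kernel \<omega> K" and rev: "reversible \<omega> K"
begin

lemma K_prob: "K \<in> \<omega> \<rightarrow>\<^sub>M prob_algebra \<omega>"
  using kernel by (simp add: markov_kernel_def)

lemma K_subprob[measurable]: "K \<in> \<omega> \<rightarrow>\<^sub>M subprob_algebra \<omega>"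
  by (rule measurable_prob_algebraD[OF K_prob])

lemma prob_space_K: "x \<in> space \<omega> \<Longrightarrow> prob_space (K x)"
  using measurable_space[OF K_prob] by (auto simp: space_prob_algebra)

lemma sets_K: "x \<in> space \<omega> \<Longrightarrow> sets (K x) = sets \<omega>"
  by (rule sets_kernel[OF K_subprob])

lemma emeasure_K_space: "x \<in> space \<omega> \<Longrightarrow> emeasure (K x) (space \<omega>) = 1"
  using prob_space.emeasure_space_1[OF prob_space_K] sets_eq_imp_space_eq[OF sets_K] by simp

lemma joint_kernel: "(\<lambda>x. distr (K x) (\<omega> \<Otimes>\<^sub>M \<omega>) (Pair x)) \<in> \<omega> \<rightarrow>\<^sub>M prob_algebra (\<omega> \<Otimes>\<^sub>M \<omega>)"
  by (rule measurable_distr_prob_space2[OF K_prob]) simp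

lemmas joint_kernel_subprob = measurable_prob_algebraD[OF joint_kernel]

lemma sets_joint[measurable_cong]: "sets (joint \<omega> K) = sets (\<omega> \<Otimes>\<^sub>M \<omega>)"
  unfolding joint_def by (rule sets_bind[OF _ not_empty]) simp

lemma space_joint: "space (joint \<omega> K) = space \<omega> \<times> space \<omega>"
  using sets_eq_imp_space_eq[OF sets_joint] by (simp add: space_pair_measure)

lemma Pair_measurable_K: "x \<in> space \<omega> \<Longrightarrow> Pair x \<in> K x \<rightarrow>\<^sub>M \<omega> \<Otimes>\<^sub>M \<omega>"
  using measurable_Pair1'[of x \<omega> \<omega>] by (simp cong: measurable_cong_sets add: sets_K)

lemma nn_integral_joint:
  assumes h[measurable]: "h \<in> borel_measurable (\<omega> \<Otimes>\<^sub>M \<omega>)"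
  shows "(\<integral>\<^sup>+z. h z \<partial>joint \<omega> K) = (\<integral>\<^sup>+x. \<integral>\<^sup>+y. h (x, y) \<partial>K x \<partial>\<omega>)"
  unfolding joint_def nn_integral_bind[OF h joint_kernel_subprob]
  by (intro nn_integral_cong nn_integral_distr Pair_measurable_K) auto

lemma integral_joint:
  fixes h :: "_ \<Rightarrow> real"
  assumes h: "integrable (joint \<omega> K) h"
  shows "integral\<^sup>L (joint \<omega> K) h = (\<integral>x. \<integral>y. h (x, y) \<partial>K x \<partial>\<omega>)"
proof -
  have hm: "h \<in> borel_measurable (\<omega> \<Otimes>\<^sub>M \<omega>)"
    using borel_measurable_integrable[OF h] by (simp cong: measurable_cong_sets add: sets_joint)
  show ?thesis
    using integrable_bind(2)[OF joint_kernel_subprob h[unfolded joint_def] not_empty]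
    by (auto simp: joint_def integral_distr[OF Pair_measurable_K hm] intro!: Bochner_Integration.integral_cong)
qed

lemma prob_space_joint: "prob_space (joint \<omega> K)"
  unfolding joint_def
  by (rule prob_space_bind'[OF _ joint_kernel]) (simp add: space_prob_algebra prob_space_axioms)

lemma emeasure_joint:
  assumes "A \<in> sets \<omega>" "B \<in> sets \<omega>"
  shows "emeasure (joint \<omega> K) (A \<times> B) = (\<integral>\<^sup>+x\<in>A. emeasure (K x) B \<partial>\<omega>)"
proof -
  have "emeasure (joint \<omega> K) (A \<times> B) = (\<integral>\<^sup>+z. indicator (A \<times> B) z \<partial>joint \<omega> K)"
    using assms by (subst nn_integral_indicator) (auto simp: sets_joint)
  also have "\<dots> = (\<integral>\<^sup>+x. \<integral>\<^sup>+y. indicator B y * indicator A x \<partial>K x \<partial>\<omega>)"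
    using assms
    by (subst nn_integral_joint) (auto intro!: nn_integral_cong simp: indicator_def)
  also have "\<dots> = (\<integral>\<^sup>+x\<in>A. emeasure (K x) B \<partial>\<omega>)"
    using assms by (auto intro!: nn_integral_cong simp: nn_integral_multc sets_K split: split_indicator)
  finally show ?thesis .
qed

text \<open>On rectangles this is exactly the reversibility identity; rectangles form an
  intersection-stable generator, so the two finite measures agree.\<close>

lemma distr_joint_swap: "distr (joint \<omega> K) (\<omega> \<Otimes>\<^sub>M \<omega>) prod.swap = joint \<omega> K"
proof (rule measure_eqI_generator_eq[OF Int_stable_pair_measure_generator[of \<omega> \<omega>]])
  let ?E = "{a \<times> b |a b. a \<in> sets \<omega> \<and> b \<in> sets \<omega>}"
  have [measurable]: "prod.swap \<in> \<omega> \<Otimes>\<^sub>M \<omega> \<rightarrow>\<^sub>M \<omega> \<Otimes>\<^sub>M \<omega>"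
    unfolding prod.swap_def by measurable
  interpret J: prob_space "joint \<omega> K" by (rule prob_space_joint)
  show "?E \<subseteq> Pow (space \<omega> \<times> space \<omega>)"
    by (auto dest: sets.sets_into_space)
  show "sets (distr (joint \<omega> K) (\<omega> \<Otimes>\<^sub>M \<omega>) prod.swap) = sigma_sets (space \<omega> \<times> space \<omega>) ?E"
    "sets (joint \<omega> K) = sigma_sets (space \<omega> \<times> space \<omega>) ?E"
    by (simp_all add: sets_joint sets_pair_measure)
  show "range (\<lambda>_::nat. space \<omega> \<times> space \<omega>) \<subseteq> ?E" "(\<Union>_::nat. space \<omega> \<times> space \<omega>) = space \<omega> \<times> space \<omega>"
    by auto
  show "emeasure (distr (joint \<omega> K) (\<omega> \<Otimes>\<^sub>M \<omega>) prod.swap) (space \<omega> \<times> space \<omega>) \<noteq> \<infinity>" for i :: nat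
    by (subst emeasure_distr) auto
  fix S assume "S \<in> ?E"
  then obtain A B where S: "S = A \<times> B" and AB: "A \<in> sets \<omega>" "B \<in> sets \<omega>" by auto
  have "emeasure (distr (joint \<omega> K) (\<omega> \<Otimes>\<^sub>M \<omega>) prod.swap) S = emeasure (joint \<omega> K) (B \<times> A)"
    using AB sets.sets_into_space[OF AB(1)] sets.sets_into_space[OF AB(2)]
    by (subst emeasure_distr) (auto simp: S space_joint intro!: arg_cong[where f="emeasure _"])
  also have "\<dots> = emeasure (joint \<omega> K) S"
    using rev AB by (simp add: S emeasure_joint reversible_def)
  finally show "emeasure (distr (joint \<omega> K) (\<omega> \<Otimes>\<^sub>M \<omega>) prod.swap) S = emeasure (joint \<omega> K) S" .
qed

lemma swap_measurable_joint: "prod.swap \<in> joint \<omega> K \<rightarrow>\<^sub>M \<omega> \<Otimes>\<^sub>M \<omega>"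
  unfolding prod.swap_def by measurable

lemma distr_joint_fst: "distr (joint \<omega> K) \<omega> fst = \<omega>"
proof (rule measure_eqI)
  fix A assume "A \<in> sets (distr (joint \<omega> K) \<omega> fst)"
  then have A: "A \<in> sets \<omega>" by simp
  have "emeasure (distr (joint \<omega> K) \<omega> fst) A = emeasure (joint \<omega> K) (A \<times> space \<omega>)"
    using A sets.sets_into_space[OF A]
    by (subst emeasure_distr) (auto simp: space_joint intro!: arg_cong[where f="emeasure _"])
  also have "\<dots> = (\<integral>\<^sup>+x. indicator A x \<partial>\<omega>)"
    using A by (subst emeasure_joint)
      (auto simp: emeasure_K_space simp del: nn_integral_indicator intro!: nn_integral_cong)
  finally show "emeasure (distr (joint \<omega> K) \<omega> fst) A = emeasure \<omega> A"
    using A by simp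
qed simp

text \<open>Stationarity of \<omega>: the swap turns the second marginal into the first, and the
  first is \<omega> because each \<open>K x\<close> has mass 1.\<close>

lemma distr_joint_snd: "distr (joint \<omega> K) \<omega> snd = \<omega>"
proof -
  have "distr (joint \<omega> K) \<omega> snd = distr (distr (joint \<omega> K) (\<omega> \<Otimes>\<^sub>M \<omega>) prod.swap) \<omega> fst"
    by (subst distr_distr) (auto simp: swap_measurable_joint comp_def)
  then show ?thesis by (simp add: distr_joint_swap distr_joint_fst)
qed

lemma L2_joint_fst: "f \<in> L2 \<omega> \<Longrightarrow> (\<lambda>z. f (fst z)) \<in> L2 (joint \<omega> K)"
  using integrable_distr_eq[of fst "joint \<omega> K" \<omega> "\<lambda>x. (f x)\<^sup>2"] by (auto simp: L2_def distr_joint_fst)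

lemma L2_joint_snd: "f \<in> L2 \<omega> \<Longrightarrow> (\<lambda>z. f (snd z)) \<in> L2 (joint \<omega> K)"
  using integrable_distr_eq[of snd "joint \<omega> K" \<omega> "\<lambda>x. (f x)\<^sup>2"] by (auto simp: L2_def distr_joint_snd)

lemma integral_joint_fst: "f \<in> borel_measurable \<omega> \<Longrightarrow> (\<integral>z. f (fst z) \<partial>joint \<omega> K) = (\<integral>x. (f x :: real) \<partial>\<omega>)"
  using integral_distr[of fst "joint \<omega> K" \<omega> f] by (simp add: distr_joint_fst)

lemma integral_joint_snd: "f \<in> borel_measurable \<omega> \<Longrightarrow> (\<integral>z. f (snd z) \<partial>joint \<omega> K) = (\<integral>x. (f x :: real) \<partial>\<omega>)"
  using integral_distr[of snd "joint \<omega> K" \<omega> f] by (simp add: distr_joint_snd)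

lemma kernel_op_measurable[measurable]:
  "f \<in> borel_measurable \<omega> \<Longrightarrow> kernel_op K f \<in> borel_measurable \<omega>"
  unfolding kernel_op_def by (rule measurable_compose[OF K_subprob integral_measurable_subprob_algebra])

lemma l2_inner_kernel_op:
  assumes "f \<in> L2 \<omega>" "g \<in> L2 \<omega>"
  shows "l2_inner \<omega> f (kernel_op K g) = (\<integral>z. f (fst z) * g (snd z) \<partial>joint \<omega> K)"
  using integral_joint[OF L2_integrable_mult[OF L2_joint_fst[OF assms(1)] L2_joint_snd[OF assms(2)]]]
  by (simp add: l2_inner_def kernel_op_def)

lemma self_adjoint:
  assumes "f \<in> L2 \<omega>" "g \<in> L2 \<omega>"
  shows "l2_inner \<omega> f (kernel_op K g) = l2_inner \<omega> g (kernel_op K f)"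
proof -
  have [measurable]: "f \<in> borel_measurable \<omega>" "g \<in> borel_measurable \<omega>"
    using assms by (auto simp: L2_def)
  have "(\<integral>z. f (fst z) * g (snd z) \<partial>joint \<omega> K)
      = (\<integral>z. f (fst z) * g (snd z) \<partial>distr (joint \<omega> K) (\<omega> \<Otimes>\<^sub>M \<omega>) prod.swap)"
    by (simp add: distr_joint_swap)
  also have "\<dots> = (\<integral>z. g (fst z) * f (snd z) \<partial>joint \<omega> K)"
    by (subst integral_distr[OF swap_measurable_joint]) (auto simp: mult.commute)
  finally show ?thesis using assms by (simp add: l2_inner_kernel_op)
qed

text \<open>By stationarity f composed with \<open>snd\<close> is integrable under the joint law,
  and almost every section of an integrable function is integrable. This makes the value
  \<open>kernel_op K f x\<close> a genuine integral for almost every x.\<close>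

lemma AE_integrable_K:
  assumes f: "integrable \<omega> (f :: 'b \<Rightarrow> real)"
  shows "AE x in \<omega>. integrable (K x) f"
proof -
  note [measurable] = borel_measurable_integrable[OF f]
  have "integrable (joint \<omega> K) (\<lambda>z. f (snd z))"
    using f integrable_distr_eq[of snd "joint \<omega> K" \<omega> f] by (simp add: distr_joint_snd)
  from integrable_bind(1)[OF joint_kernel_subprob this[unfolded joint_def] not_empty] AE_space
  show ?thesis
    by eventually_elim (simp add: integrable_distr_eq[OF Pair_measurable_K])
qed

text \<open>Nonnegativity of the variance of f under \<open>K x\<close> gives (K f)^2 \<le> K (f^2)
  almost everywhere, and by stationarity the right side has the same integral as f^2.\<close>

lemma kernel_op_contraction:
  assumes f: "f \<in> L2 \<omega>"
  shows "kernel_op K f \<in> L2 \<omega>" and "l2_norm \<omega> (kernel_op K f) \<le> l2_norm \<omega> f"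
proof -
  have [measurable]: "f \<in> borel_measurable \<omega>" and f2: "integrable \<omega> (\<lambda>x. (f x)\<^sup>2)"
    using f by (auto simp: L2_def)
  have i: "integrable (joint \<omega> K) (\<lambda>z. (f (snd z))\<^sup>2)"
    using L2_joint_snd[OF f] by (simp add: L2_def)
  have le: "AE x in \<omega>. (kernel_op K f x)\<^sup>2 \<le> kernel_op K (\<lambda>y. (f y)\<^sup>2) x"
    using AE_integrable_K[OF L2_integrable[OF f]] AE_integrable_K[OF f2] AE_space
  proof eventually_elim
    case (elim x)
    interpret Kx: prob_space "K x" by (rule prob_space_K) fact
    have "0 \<le> (\<integral>y. (f y)\<^sup>2 \<partial>K x) - (\<integral>y. f y \<partial>K x)\<^sup>2"
      unfolding Kx.variance_eq[OF elim(1,2), symmetric] by (rule Kx.variance_positive)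
    then show ?case unfolding kernel_op_def by simp
  qed
  have mf2: "(\<integral>x. kernel_op K (\<lambda>y. (f y)\<^sup>2) x \<partial>\<omega>) = (\<integral>x. (f x)\<^sup>2 \<partial>\<omega>)"
    using integral_joint[OF i] by (simp add: kernel_op_def integral_joint_snd[of "\<lambda>x. (f x)\<^sup>2"])
  have int2: "integrable \<omega> (kernel_op K (\<lambda>y. (f y)\<^sup>2))"
  proof (rule integrableI_nonneg)
    show "AE x in \<omega>. 0 \<le> kernel_op K (\<lambda>y. (f y)\<^sup>2) x" by (simp add: kernel_op_def)
    have "(\<integral>\<^sup>+x. ennreal (kernel_op K (\<lambda>y. (f y)\<^sup>2) x) \<partial>\<omega>) = (\<integral>\<^sup>+x. \<integral>\<^sup>+y. ennreal ((f y)\<^sup>2) \<partial>K x \<partial>\<omega>)"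
      using AE_integrable_K[OF f2]
      by (intro nn_integral_cong_AE) (auto elim!: eventually_mono simp: kernel_op_def nn_integral_eq_integral)
    also have "\<dots> = (\<integral>\<^sup>+z. ennreal ((f (snd z))\<^sup>2) \<partial>joint \<omega> K)"
      by (subst nn_integral_joint) auto
    also have "\<dots> < \<infinity>"
      using i by (simp add: nn_integral_eq_integral)
    finally show "(\<integral>\<^sup>+x. ennreal (kernel_op K (\<lambda>y. (f y)\<^sup>2) x) \<partial>\<omega>) < \<infinity>" .
  qed measurable
  have int: "integrable \<omega> (\<lambda>x. (kernel_op K f x)\<^sup>2)"
    by (rule Bochner_Integration.integrable_bound[OF int2]) (use le in \<open>auto elim!: eventually_mono\<close>)
  then show "kernel_op K f \<in> L2 \<omega>" by (simp add: L2_def)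
  have "(\<integral>x. (kernel_op K f x)\<^sup>2 \<partial>\<omega>) \<le> (\<integral>x. (f x)\<^sup>2 \<partial>\<omega>)"
    unfolding mf2[symmetric] by (rule integral_mono_AE[OF int int2 le])
  then show "l2_norm \<omega> (kernel_op K f) \<le> l2_norm \<omega> f"
    by (simp add: l2_norm_def l2_inner_def power2_eq_square)
qed

text \<open>The inner product of K f with the constant 1 is the mean of f, again by
  stationarity.\<close>

lemma kernel_op_L2_0:
  assumes f: "f \<in> L2_0 \<omega>"
  shows "kernel_op K f \<in> L2_0 \<omega>"
proof -
  have f': "f \<in> L2 \<omega>" "(\<integral>x. f x \<partial>\<omega>) = 0" using f by (auto simp: L2_0_def)
  have "l2_inner \<omega> (\<lambda>_. 1) (kernel_op K f) = (\<integral>x. f x \<partial>\<omega>)"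
    using l2_inner_kernel_op[OF L2_const[of 1] f'(1)] integral_joint_snd[of f] f'(1) by (simp add: L2_def)
  then show ?thesis
    using kernel_op_contraction(1)[OF f'(1)] f'(2) by (simp add: L2_0_def l2_inner_def)
qed

text \<open>A real \<open>Sup\<close> carries information only for a set bounded above; the
  contraction property supplies the bound 1. Functions that vanish almost everywhere are excluded
  from the supremum, so for them the last estimate comes from the contraction property as
  well.\<close>

lemma kernel_norm_bounds:
  shows "0 \<le> kernel_norm \<omega> K" and "kernel_norm \<omega> K \<le> 1"
    and "f \<in> L2_0 \<omega> \<Longrightarrow> l2_norm \<omega> (kernel_op K f) \<le> kernel_norm \<omega> K * l2_norm \<omega> f"
proof -
  let ?S = "insert 0 {l2_norm \<omega> (kernel_op K f) / l2_norm \<omega> f | f. f \<in> L2_0 \<omega> \<and> \<not> (AE y in \<omega>. f y = 0)}"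
  have "l2_norm \<omega> (kernel_op K f) / l2_norm \<omega> f \<le> 1" if "f \<in> L2_0 \<omega>" for f
    using kernel_op_contraction(2)[of f] that l2_norm_nonneg[of \<omega> f] by (intro divide_le_eq_1[THEN iffD2]) (auto simp: L2_0_def)
  then have le1: "s \<le> 1" if "s \<in> ?S" for s
    using that by auto
  then have bdd: "bdd_above ?S" by (rule bdd_aboveI)
  show "0 \<le> kernel_norm \<omega> K"
    unfolding kernel_norm_def by (rule cSup_upper[OF insertI1 bdd])
  show "kernel_norm \<omega> K \<le> 1"
    unfolding kernel_norm_def by (rule cSup_least[OF insert_not_empty le1])
  assume f: "f \<in> L2_0 \<omega>"
  then have f': "f \<in> L2 \<omega>" by (simp add: L2_0_def)
  show "l2_norm \<omega> (kernel_op K f) \<le> kernel_norm \<omega> K * l2_norm \<omega> f"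
  proof (cases "AE y in \<omega>. f y = 0")
    case True
    then have "l2_norm \<omega> f = 0" using f' by (simp add: l2_norm_eq_0_iff)
    then show ?thesis using kernel_op_contraction(2)[OF f'] by simp
  next
    case False
    then have "l2_norm \<omega> f > 0"
      using l2_norm_eq_0_iff[OF f'] l2_norm_nonneg[of \<omega> f] by simp
    moreover have "l2_norm \<omega> (kernel_op K f) / l2_norm \<omega> f \<le> kernel_norm \<omega> K"
      unfolding kernel_norm_def using f False by (intro cSup_upper bdd) auto
    ultimately show ?thesis by (simp add: field_simps)
  qed
qed

lemma quadratic_form_le_kernel_norm:
  assumes f: "f \<in> L2_0 \<omega>"
  shows "\<bar>l2_inner \<omega> f (kernel_op K f)\<bar> \<le> kernel_norm \<omega> K * l2_inner \<omega> f f"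
proof -
  have f': "f \<in> L2 \<omega>" using f by (simp add: L2_0_def)
  have "\<bar>l2_inner \<omega> f (kernel_op K f)\<bar> \<le> l2_norm \<omega> f * l2_norm \<omega> (kernel_op K f)"
    by (rule l2_Cauchy_Schwarz[OF f' kernel_op_contraction(1)[OF f']])
  also have "\<dots> \<le> l2_norm \<omega> f * (kernel_norm \<omega> K * l2_norm \<omega> f)"
    by (intro mult_left_mono kernel_norm_bounds f l2_norm_nonneg)
  finally show ?thesis
    by (simp add: l2_norm_power2[symmetric] power2_eq_square mult_ac)
qed

text \<open>\<open>kernel_op K\<close> is additive at x only where the functions are integrable
  under \<open>K x\<close>. Self-adjointness moves the sum to the other argument of the inner
  product, where linearity holds for all of L2 and no exceptional set appears.\<close>

lemma quadratic_form_add_cmult: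
  assumes "f \<in> L2 \<omega>" "g \<in> L2 \<omega>"
  shows "l2_inner \<omega> (\<lambda>x. f x + c * g x) (kernel_op K (\<lambda>x. f x + c * g x))
    = l2_inner \<omega> f (kernel_op K f) + 2 * c * l2_inner \<omega> f (kernel_op K g) + c\<^sup>2 * l2_inner \<omega> g (kernel_op K g)"
proof -
  note kL = kernel_op_contraction(1)
  have *: "l2_inner \<omega> h (kernel_op K (\<lambda>x. f x + c * g x))
    = l2_inner \<omega> h (kernel_op K f) + c * l2_inner \<omega> h (kernel_op K g)" if "h \<in> L2 \<omega>" for h
    using that assms self_adjoint[of h f] self_adjoint[of h g] self_adjoint[of h "\<lambda>x. f x + c * g x"]
    by (simp add: L2_add L2_cmult kL l2_inner_add_left l2_inner_cmult_left)
  show ?thesis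
    using assms self_adjoint[of f g]
    by (simp add: * L2_add L2_cmult kL l2_inner_add_left l2_inner_cmult_left power2_eq_square algebra_simps)
qed

text \<open>Polarization: compare the quadratic form at $f + t\,Kf$ and $f - t\,Kf$ with
  $t = \|f\| / \|Kf\|$.\<close>

lemma kernel_norm_le:
  assumes c: "0 \<le> c"
    and bound: "\<And>f. f \<in> L2_0 \<omega> \<Longrightarrow> \<bar>l2_inner \<omega> f (kernel_op K f)\<bar> \<le> c * l2_inner \<omega> f f"
  shows "kernel_norm \<omega> K \<le> c"
proof -
  have "l2_norm \<omega> (kernel_op K f) / l2_norm \<omega> f \<le> c"
    if f: "f \<in> L2_0 \<omega>" and nz: "\<not> (AE y in \<omega>. f y = 0)" for f
  proof -
    let ?g = "kernel_op K f"
    let ?a = "l2_norm \<omega> f" and ?b = "l2_norm \<omega> ?g"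
    have f': "f \<in> L2 \<omega>" "?g \<in> L2 \<omega>" and g: "?g \<in> L2_0 \<omega>"
      using f kernel_op_L2_0[OF f] by (auto simp: L2_0_def)
    have a: "?a > 0"
      using nz l2_norm_eq_0_iff[OF f'(1)] l2_norm_nonneg[of \<omega> f] by simp
    have inL: "(\<lambda>x. f x + t * ?g x) \<in> L2_0 \<omega>" for t
      using f g by (auto simp: L2_0_def L2_add L2_cmult L2_integrable)
    have norm: "l2_inner \<omega> (\<lambda>x. f x + t * ?g x) (\<lambda>x. f x + t * ?g x)
        = ?a\<^sup>2 + 2 * t * l2_inner \<omega> f ?g + t\<^sup>2 * ?b\<^sup>2" for t
      using f' by (simp add: l2_inner_add_left l2_inner_add_right L2_add L2_cmult l2_inner_cmult_left
          l2_inner_cmult_right l2_inner_commute[of \<omega> ?g f] l2_norm_power2 power2_eq_square[of t] algebra_simps)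
    \<comment> \<open>Self-adjointness: <f, K g> = <g, K f> = <g, g>. So the cross term of the
      quadratic form is the quantity to be estimated.\<close>
    have gKf: "l2_inner \<omega> f (kernel_op K ?g) = ?b\<^sup>2"
      by (subst self_adjoint[OF f']) (simp add: l2_norm_power2)
    \<comment> \<open>Subtracting the two forms leaves only the cross terms, while in the sum of the
      two squared norms the terms linear in t cancel.\<close>
    have main: "4 * t * ?b\<^sup>2 \<le> 2 * c * (?a\<^sup>2 + t\<^sup>2 * ?b\<^sup>2)" for t
    proof -
      have "4 * t * ?b\<^sup>2 = l2_inner \<omega> (\<lambda>x. f x + t * ?g x) (kernel_op K (\<lambda>x. f x + t * ?g x))
          - l2_inner \<omega> (\<lambda>x. f x + (- t) * ?g x) (kernel_op K (\<lambda>x. f x + (- t) * ?g x))"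
        unfolding quadratic_form_add_cmult[OF f'] gKf by simp
      also have "\<dots> \<le> c * l2_inner \<omega> (\<lambda>x. f x + t * ?g x) (\<lambda>x. f x + t * ?g x)
         + c * l2_inner \<omega> (\<lambda>x. f x + (- t) * ?g x) (\<lambda>x. f x + (- t) * ?g x)"
        using bound[OF inL[of t]] bound[OF inL[of "- t"]] by linarith
      also have "\<dots> = 2 * c * (?a\<^sup>2 + t\<^sup>2 * ?b\<^sup>2)"
        unfolding norm by (simp add: algebra_simps)
      finally show ?thesis .
    qed
    show ?thesis
    proof (cases "?b = 0")
      case True then show ?thesis using c by simp
    next
      case False
      then have b: "?b > 0" using l2_norm_nonneg[of \<omega> ?g] by simp
      have "4 * ?a * ?b \<le> 4 * c * ?a\<^sup>2"
        using main[of "?a / ?b"] b by (simp add: power2_eq_square field_simps)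
      then show ?thesis using a by (simp add: power2_eq_square field_simps)
    qed
  qed
  then show ?thesis
    unfolding kernel_norm_def using c by (intro cSup_least) auto
qed

text \<open>Expand the square under the joint law. Both marginals are \<omega>, so each pure square
  contributes \<parallel>f\<parallel>^2; this is where the factor 2 arises.\<close>

lemma energy_eq:
  assumes f: "f \<in> L2 \<omega>"
  shows "energy \<omega> K f = ennreal (2 * (l2_inner \<omega> f f - l2_inner \<omega> f (kernel_op K f)))"
proof -
  have [measurable]: "f \<in> borel_measurable \<omega>" using f by (simp add: L2_def)
  note fs = L2_joint_fst[OF f] L2_joint_snd[OF f]
  note i = L2_integrable_mult[OF fs(1) fs(1)] L2_integrable_mult[OF fs(1) fs(2)] L2_integrable_mult[OF fs(2) fs(2)]
  have sq: "(a - b)\<^sup>2 = a * a - 2 * (a * b) + b * b" for a b :: real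
    by (simp add: power2_eq_square algebra_simps)
  have sq_int: "integrable (joint \<omega> K) (\<lambda>z. (f (fst z) - f (snd z))\<^sup>2)"
    unfolding sq using i by simp
  have "energy \<omega> K f = (\<integral>\<^sup>+z. ennreal ((f (fst z) - f (snd z))\<^sup>2) \<partial>joint \<omega> K)"
    unfolding energy_def by (subst nn_integral_joint) auto
  also have "\<dots> = ennreal (\<integral>z. (f (fst z) - f (snd z))\<^sup>2 \<partial>joint \<omega> K)"
    by (intro nn_integral_eq_integral sq_int) simp
  also have "(\<integral>z. (f (fst z) - f (snd z))\<^sup>2 \<partial>joint \<omega> K) = 2 * (l2_inner \<omega> f f - l2_inner \<omega> f (kernel_op K f))"
    unfolding sq using i integral_joint_fst[of "\<lambda>x. f x * f x"] integral_joint_snd[of "\<lambda>x. f x * f x"]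
    by (simp add: l2_inner_kernel_op[OF f f] l2_inner_def[of \<omega> f f])
  finally show ?thesis .
qed

text \<open>Ensures that the real number under \<open>ennreal\<close> in \<open>energy_eq\<close> is
  nonnegative, so that nothing is truncated and energy inequalities can be read back in the
  reals.\<close>

lemma l2_inner_kernel_op_le: "f \<in> L2 \<omega> \<Longrightarrow> l2_inner \<omega> f (kernel_op K f) \<le> l2_inner \<omega> f f"
proof -
  assume f: "f \<in> L2 \<omega>"
  have "l2_inner \<omega> f (kernel_op K f) \<le> l2_norm \<omega> f * l2_norm \<omega> (kernel_op K f)"
    using l2_Cauchy_Schwarz[OF f kernel_op_contraction(1)[OF f]] by linarith
  also have "\<dots> \<le> l2_norm \<omega> f * l2_norm \<omega> f"
    by (intro mult_left_mono kernel_op_contraction f l2_norm_nonneg)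
  finally show ?thesis by (simp add: l2_norm_power2[symmetric] power2_eq_square)
qed

end

section \<open>Energy compared with that of independent sampling\<close>

lemma (in prob_space) reversible_kernel_const: "reversible_kernel M (\<lambda>_. M)"
proof
  show "markov_kernel M (\<lambda>_. M)"
    unfolding markov_kernel_def by (rule measurable_const) (simp add: space_prob_algebra prob_space_axioms)
  show "reversible M (\<lambda>_. M)"
    unfolding reversible_def by (simp add: nn_integral_cmult_indicator) (simp add: mult.commute)
qed

lemma energy_shift: "energy \<omega> K (\<lambda>x. f x - c) = energy \<omega> K f"
  by (simp add: energy_def)

text \<open>Replace f by its centering g, which has the same energy for every kernel. The constant
  kernel maps g to its mean 0, so its energy is 2 \<parallel>g\<parallel>^2, and |<g, K g>| is at
  most the kernel norm times \<parallel>g\<parallel>^2.\<close>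

lemma (in reversible_kernel) energy_bounds:
  assumes f: "f \<in> L2 \<omega>"
  shows "energy \<omega> K f \<le> ennreal (1 + kernel_norm \<omega> K) * energy \<omega> (\<lambda>_. \<omega>) f"
    and "ennreal (1 - kernel_norm \<omega> K) * energy \<omega> (\<lambda>_. \<omega>) f \<le> energy \<omega> K f"
    and "pos_semidef \<omega> K \<Longrightarrow> energy \<omega> K f \<le> energy \<omega> (\<lambda>_. \<omega>) f"
    and "energy \<omega> (\<lambda>_. \<omega>) f \<le> 2 * (\<integral>\<^sup>+x. ennreal ((f x)\<^sup>2) \<partial>\<omega>)"
proof -
  interpret c: reversible_kernel \<omega> "\<lambda>_. \<omega>" by (rule reversible_kernel_const)
  let ?m = "\<integral>x. f x \<partial>\<omega>"
  define g where "g = (\<lambda>x. f x - ?m)"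
  have g2: "g \<in> L2 \<omega>"
    using L2_add[OF f L2_const[of "- ?m"]] by (simp add: g_def)
  have "(\<integral>x. g x \<partial>\<omega>) = 0"
    using L2_integrable[OF f] by (simp add: g_def prob_space)
  then have g: "g \<in> L2_0 \<omega>" using g2 by (simp add: L2_0_def)
  have e: "energy \<omega> K' f = energy \<omega> K' g" for K'
    by (simp add: g_def energy_shift)
  have V: "energy \<omega> (\<lambda>_. \<omega>) f = ennreal (2 * l2_inner \<omega> g g)"
    using c.energy_eq[OF g2] g by (simp add: e l2_inner_def kernel_op_def L2_0_def)
  note q = quadratic_form_le_kernel_norm[OF g]
  note kn = kernel_norm_bounds(1,2) l2_inner_self_nonneg[of \<omega> g]
  have bounds: "2 * (l2_inner \<omega> g g - l2_inner \<omega> g (kernel_op K g)) \<le> (1 + kernel_norm \<omega> K) * (2 * l2_inner \<omega> g g)"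
    "(1 - kernel_norm \<omega> K) * (2 * l2_inner \<omega> g g) \<le> 2 * (l2_inner \<omega> g g - l2_inner \<omega> g (kernel_op K g))"
    using q by (auto simp: algebra_simps abs_le_iff)
  show "energy \<omega> K f \<le> ennreal (1 + kernel_norm \<omega> K) * energy \<omega> (\<lambda>_. \<omega>) f"
    unfolding e[of K] energy_eq[OF g2] V using kn bounds
    by (subst ennreal_mult'[symmetric]) (auto intro!: ennreal_leI)
  show "ennreal (1 - kernel_norm \<omega> K) * energy \<omega> (\<lambda>_. \<omega>) f \<le> energy \<omega> K f"
    unfolding e[of K] energy_eq[OF g2] V using kn bounds
    by (subst ennreal_mult'[symmetric]) (auto intro!: ennreal_leI)
  show "energy \<omega> K f \<le> energy \<omega> (\<lambda>_. \<omega>) f" if "pos_semidef \<omega> K"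
    unfolding e[of K] energy_eq[OF g2] V using that g by (auto simp: pos_semidef_def intro!: ennreal_leI)
  \<comment> \<open>The last bound uses f itself, not g: the form of the constant kernel at f is the
    square of the mean, and dropping it leaves 2 \<parallel>f\<parallel>^2.\<close>
  have fi: "l2_inner \<omega> f (kernel_op (\<lambda>_. \<omega>) f) = ?m * ?m"
    by (simp add: l2_inner_def kernel_op_def)
  have "energy \<omega> (\<lambda>_. \<omega>) f \<le> ennreal (2 * l2_inner \<omega> f f)"
    unfolding c.energy_eq[OF f] fi by (intro ennreal_leI) simp
  also have "\<dots> = 2 * (\<integral>\<^sup>+x. ennreal ((f x)\<^sup>2) \<partial>\<omega>)"
    using f by (simp add: L2_def l2_inner_def nn_integral_eq_integral power2_eq_square ennreal_mult')
  finally show "energy \<omega> (\<lambda>_. \<omega>) f \<le> 2 * (\<integral>\<^sup>+x. ennreal ((f x)\<^sup>2) \<partial>\<omega>)" .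
qed

section \<open>Mixtures of reversible kernels\<close>

text \<open>\<open>N\<close> is known only through its values on sets. The identity therefore starts
  at indicators and passes through linear combinations to monotone limits, where the suprema commute
  with the sum because every summand is increasing.\<close>

lemma nn_integral_mixture:
  assumes h: "h \<in> borel_measurable N"
    and sets: "\<And>i. i \<in> I \<Longrightarrow> sets (U i) = sets N"
    and em: "\<And>A. A \<in> sets N \<Longrightarrow> emeasure N A = (\<Sum>i\<in>I. c i * emeasure (U i) A)"
  shows "(\<integral>\<^sup>+x. h x \<partial>N) = (\<Sum>i\<in>I. c i * (\<integral>\<^sup>+x. h x \<partial>U i))"
  using h
proof (induction rule: borel_measurable_induct)
  case (cong f g)
  have "(\<integral>\<^sup>+x. f x \<partial>U i) = (\<integral>\<^sup>+x. g x \<partial>U i)" if "i \<in> I" for i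
    using cong(3) sets_eq_imp_space_eq[OF sets[OF that]] by (intro nn_integral_cong) simp
  moreover have "(\<integral>\<^sup>+x. f x \<partial>N) = (\<integral>\<^sup>+x. g x \<partial>N)"
    using cong(3) by (intro nn_integral_cong)
  ultimately show ?case using cong(4) by simp
next
  case (set A)
  then show ?case by (simp add: sets em cong: sum.cong)
next
  case (mult u a)
  have [measurable]: "u \<in> borel_measurable (U i)" if "i \<in> I" for i
    using mult(2) sets[OF that] by (simp cong: measurable_cong_sets)
  show ?case using mult
    by (simp add: nn_integral_cmult sum_distrib_left mult.left_commute cong: sum.cong)
next
  case (add u v)
  have [measurable]: "u \<in> borel_measurable (U i)" "v \<in> borel_measurable (U i)" if "i \<in> I" for i
    using add(1,3) sets[OF that] by (simp_all cong: measurable_cong_sets)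
  show ?case using add
    by (simp add: nn_integral_add sum.distrib distrib_left cong: sum.cong)
next
  case (seq F)
  have [measurable]: "F k \<in> borel_measurable (U i)" if "i \<in> I" for i k
    using seq(1) sets[OF that] by (simp cong: measurable_cong_sets)
  have mono: "incseq (\<lambda>k. c i * (\<integral>\<^sup>+x. F k x \<partial>U i))" for i
    using seq(3) by (auto simp: incseq_def le_fun_def intro!: mult_left_mono nn_integral_mono)
  have "(\<integral>\<^sup>+x. (SUP k. F k) x \<partial>N) = (SUP k. \<integral>\<^sup>+x. F k x \<partial>N)"
    using seq by (simp add: nn_integral_monotone_convergence_SUP image_comp)
  also have "\<dots> = (SUP k. \<Sum>i\<in>I. c i * (\<integral>\<^sup>+x. F k x \<partial>U i))"
    using seq by simp
  also have "\<dots> = (\<Sum>i\<in>I. SUP k. c i * (\<integral>\<^sup>+x. F k x \<partial>U i))"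
    using mono by (intro ennreal_SUP_sum)
  also have "\<dots> = (\<Sum>i\<in>I. c i * (\<integral>\<^sup>+x. (SUP k. F k) x \<partial>U i))"
    using seq(3) by (intro sum.cong)
      (simp_all add: nn_integral_monotone_convergence_SUP image_comp SUP_mult_left_ennreal)
  finally show ?case .
qed

text \<open>Both Gibbs kernels are instances. \<open>K\<close> is specified by its values on sets
  because this is how \<open>random_scan\<close> is given. \<open>p_sum\<close> also makes
  \<open>I\<close> finite, since a sum over an infinite set is 0.\<close>

locale reversible_mixture = prob_space \<omega> for \<omega> :: "'b measure" +
  fixes I :: "'i set" and p :: "'i \<Rightarrow> real" and U :: "'i \<Rightarrow> 'b \<Rightarrow> 'b measure" and K :: "'b \<Rightarrow> 'b measure"
  assumes U: "\<And>i. i \<in> I \<Longrightarrow> reversible_kernel \<omega> (U i)"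
    and p_nonneg: "\<And>i. i \<in> I \<Longrightarrow> 0 \<le> p i" and p_sum: "sum p I = 1"
    and sets_K: "\<And>x. x \<in> space \<omega> \<Longrightarrow> sets (K x) = sets \<omega>"
    and emeasure_K: "\<And>x A. x \<in> space \<omega> \<Longrightarrow> A \<in> sets \<omega> \<Longrightarrow>
      emeasure (K x) A = (\<Sum>i\<in>I. ennreal (p i) * emeasure (U i x) A)"
begin

lemma emeasure_U_measurable:
  "i \<in> I \<Longrightarrow> A \<in> sets \<omega> \<Longrightarrow> (\<lambda>x. emeasure (U i x) A) \<in> borel_measurable \<omega>"
  using measurable_emeasure_kernel[OF reversible_kernel.K_subprob[OF U]] by auto

lemma sum_ennreal_p: "(\<Sum>i\<in>I. ennreal (p i)) = 1"
  using p_nonneg p_sum by (simp add: sum_ennreal)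

lemma prob_space_K: "x \<in> space \<omega> \<Longrightarrow> prob_space (K x)"
proof
  assume x: "x \<in> space \<omega>"
  have "emeasure (K x) (space (K x)) = (\<Sum>i\<in>I. ennreal (p i))"
    using x by (simp add: sets_eq_imp_space_eq[OF sets_K] emeasure_K reversible_kernel.emeasure_K_space[OF U])
  also have "\<dots> = 1"
    by (rule sum_ennreal_p)
  finally show "emeasure (K x) (space (K x)) = 1" .
qed

lemma set_nn_integral_emeasure_K:
  assumes "A \<in> sets \<omega>" "B \<in> sets \<omega>"
  shows "(\<integral>\<^sup>+x\<in>A. emeasure (K x) B \<partial>\<omega>) = (\<Sum>i\<in>I. ennreal (p i) * (\<integral>\<^sup>+x\<in>A. emeasure (U i x) B \<partial>\<omega>))"
proof -
  have [measurable]: "(\<lambda>x. emeasure (U i x) B) \<in> borel_measurable \<omega>" if "i \<in> I" for i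
    using emeasure_U_measurable[OF that assms(2)] .
  have [measurable]: "A \<in> sets \<omega>" by fact
  have "(\<integral>\<^sup>+x\<in>A. emeasure (K x) B \<partial>\<omega>)
      = (\<integral>\<^sup>+x. (\<Sum>i\<in>I. ennreal (p i) * (emeasure (U i x) B * indicator A x)) \<partial>\<omega>)"
    using assms by (intro nn_integral_cong) (simp add: emeasure_K sum_distrib_right mult.assoc)
  also have "\<dots> = (\<Sum>i\<in>I. \<integral>\<^sup>+x. ennreal (p i) * (emeasure (U i x) B * indicator A x) \<partial>\<omega>)"
    by (intro nn_integral_sum) measurable
  also have "\<dots> = (\<Sum>i\<in>I. ennreal (p i) * (\<integral>\<^sup>+x\<in>A. emeasure (U i x) B \<partial>\<omega>))"
    by (intro sum.cong refl nn_integral_cmult) measurable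
  finally show ?thesis .
qed

text \<open>For fixed sets the reversibility identity is linear in the kernel, and weights of sum 1
  preserve total mass; all results on reversible kernels thus apply to the mixture.\<close>

sublocale reversible_kernel \<omega> K
proof
  have "K \<in> \<omega> \<rightarrow>\<^sub>M subprob_algebra \<omega>"
  proof (rule measurable_subprob_algebra)
    show "subprob_space (K x)" if "x \<in> space \<omega>" for x
      using prob_space_K[OF that] by (rule prob_space_imp_subprob_space)
    show "(\<lambda>x. emeasure (K x) A) \<in> borel_measurable \<omega>" if A: "A \<in> sets \<omega>" for A
    proof (subst measurable_cong)
      show "emeasure (K x) A = (\<Sum>i\<in>I. ennreal (p i) * emeasure (U i x) A)" if "x \<in> space \<omega>" for x
        using that A by (rule emeasure_K)
      show "(\<lambda>x. \<Sum>i\<in>I. ennreal (p i) * emeasure (U i x) A) \<in> borel_measurable \<omega>"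
        using emeasure_U_measurable[OF _ A] by measurable
    qed
  qed (rule sets_K)
  then show "markov_kernel \<omega> K"
    unfolding markov_kernel_def by (intro measurable_prob_algebraI prob_space_K)
  show "reversible \<omega> K"
    unfolding reversible_def
    using reversible_kernel.rev[OF U]
    by (auto simp: set_nn_integral_emeasure_K reversible_def intro!: sum.cong)
qed

lemma energy_mixture:
  assumes [measurable]: "f \<in> borel_measurable \<omega>"
  shows "energy \<omega> K f = (\<Sum>i\<in>I. ennreal (p i) * energy \<omega> (U i) f)"
proof -
  have Um: "U i \<in> \<omega> \<rightarrow>\<^sub>M subprob_algebra \<omega>" if "i \<in> I" for i
    by (rule reversible_kernel.K_subprob[OF U[OF that]])
  have meas: "(\<lambda>x. \<integral>\<^sup>+y. ennreal ((f x - f y)\<^sup>2) \<partial>U i x) \<in> borel_measurable \<omega>" if "i \<in> I" for i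
    by (rule nn_integral_measurable_subprob_algebra2[OF _ Um[OF that]]) measurable
  have "energy \<omega> K f = (\<integral>\<^sup>+x. (\<Sum>i\<in>I. ennreal (p i) * (\<integral>\<^sup>+y. ennreal ((f x - f y)\<^sup>2) \<partial>U i x)) \<partial>\<omega>)"
    unfolding energy_def
  proof (intro nn_integral_cong nn_integral_mixture)
    fix x assume x: "x \<in> space \<omega>"
    show "(\<lambda>y. ennreal ((f x - f y)\<^sup>2)) \<in> borel_measurable (K x)"
      using sets_K[OF x] by (simp cong: measurable_cong_sets)
    show "sets (U i x) = sets (K x)" if "i \<in> I" for i
      using x by (simp add: sets_K reversible_kernel.sets_K[OF U[OF that]])
    show "emeasure (K x) A = (\<Sum>i\<in>I. ennreal (p i) * emeasure (U i x) A)" if "A \<in> sets (K x)" for A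
      using x that by (simp add: sets_K emeasure_K)
  qed
  also have "\<dots> = (\<Sum>i\<in>I. ennreal (p i) * energy \<omega> (U i) f)"
    unfolding energy_def using meas
    by (subst nn_integral_sum) (auto intro!: sum.cong nn_integral_cmult)
  finally show ?thesis .
qed

end

section \<open>Updating one coordinate\<close>

locale coordinate_update = prob_space \<pi> for \<pi> :: "(nat \<Rightarrow> 'a) measure" +
  fixes n :: nat and X :: "nat \<Rightarrow> 'a topology" and i :: nat and \<kappa> :: "(nat \<Rightarrow> 'a) \<Rightarrow> 'a measure"
  assumes i: "i \<in> {1..n}" and sets_\<pi>: "sets \<pi> = sets (full_space n X)"
    and cond: "cond_dist n X \<pi> i \<kappa>"
begin

abbreviation "F \<equiv> full_space n X"
abbreviation "D \<equiv> space_drop n X i"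
abbreviation "M \<equiv> marginal_drop n X \<pi> i"
abbreviation "B \<equiv> borel_of (X i)"

lemma space_\<pi>: "space \<pi> = space F"
  by (rule sets_eq_imp_space_eq[OF sets_\<pi>])

declare sets_\<pi>[measurable_cong]

lemma drop_measurable[measurable]: "drop_coord n i \<in> F \<rightarrow>\<^sub>M D"
  unfolding full_space_def space_drop_def drop_coord_def[abs_def] by (rule measurable_restrict_subset) auto

lemma component_measurable[measurable]: "(\<lambda>x. x i) \<in> F \<rightarrow>\<^sub>M B"
  unfolding full_space_def using i by measurable

text \<open>On points without coordinate i the update embeds a fiber into the product. Its variant
  on full points, proved next, is the move made by the kernel.\<close>

lemma upd_measurable[measurable]: "(\<lambda>(y, u). y(i := u)) \<in> D \<Otimes>\<^sub>M B \<rightarrow>\<^sub>M F"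
proof -
  have "insert i ({1..n} - {i}) = {1..n}" using i by auto
  then show ?thesis
    unfolding full_space_def space_drop_def
    using measurable_add_dim[of i "{1..n} - {i}" "\<lambda>j. borel_of (X j)"] by simp
qed

lemma upd_full_measurable[measurable]: "(\<lambda>(x, u). x(i := u)) \<in> F \<Otimes>\<^sub>M B \<rightarrow>\<^sub>M F"
proof -
  have "insert i {1..n} = {1..n}" using i by auto
  then show ?thesis
    unfolding full_space_def
    using measurable_add_dim[of i "{1..n}" "\<lambda>j. borel_of (X j)"] by simp
qed

text \<open>Points of \<open>D\<close> are \<open>undefined\<close> at i, so restricting to the
  other indices removes exactly the updated value.\<close>

lemma drop_upd: "y \<in> space D \<Longrightarrow> drop_coord n i (y(i := u)) = y"
  by (auto simp: drop_coord_def space_drop_def space_PiM PiE_def extensional_def fun_eq_iff)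

lemma sets_M: "sets M = sets D"
  by (simp add: marginal_drop_def)

lemma space_M: "space M = space D"
  by (simp add: marginal_drop_def)

lemma prob_space_M: "prob_space M"
  unfolding marginal_drop_def by (rule prob_space_distr) measurable

lemma \<kappa>_prob: "\<kappa> \<in> D \<rightarrow>\<^sub>M prob_algebra B"
  using cond by (simp add: cond_dist_def)

lemma \<kappa>_subprob[measurable]: "\<kappa> \<in> D \<rightarrow>\<^sub>M subprob_algebra B"
  by (rule measurable_prob_algebraD[OF \<kappa>_prob])

lemma prob_space_\<kappa>: "y \<in> space D \<Longrightarrow> prob_space (\<kappa> y)"
  using measurable_space[OF \<kappa>_prob] by (auto simp: space_prob_algebra)

lemma sets_\<kappa>: "y \<in> space D \<Longrightarrow> sets (\<kappa> y) = sets B"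
  by (rule sets_kernel[OF \<kappa>_subprob])

lemma upd_section_measurable: "y \<in> space D \<Longrightarrow> (\<lambda>u. y(i := u)) \<in> B \<rightarrow>\<^sub>M F"
  using measurable_compose[OF measurable_Pair1' upd_measurable] by simp

lemma upd_section_measurable_\<kappa>: "y \<in> space D \<Longrightarrow> (\<lambda>u. y(i := u)) \<in> \<kappa> y \<rightarrow>\<^sub>M F"
  using upd_section_measurable sets_\<kappa> by (simp cong: measurable_cong_sets)

lemma fiber_kernel: "(\<lambda>y. distr (\<kappa> y) F (\<lambda>u. y(i := u))) \<in> M \<rightarrow>\<^sub>M prob_algebra F"
  using measurable_distr_prob_space2[OF \<kappa>_prob upd_measurable] sets_M by (simp cong: measurable_cong_sets)

text \<open>\<open>cond_dist\<close> speaks only about events that combine a condition on x_i with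
  one on x_{-i}. Every box is such an event, and boxes determine a finite measure on the finite
  product.\<close>

lemma disintegration: "\<pi> = M \<bind> (\<lambda>y. distr (\<kappa> y) F (\<lambda>u. y(i := u)))"
proof (rule measure_eqI_PiM_finite[of "{1..n}"])
  let ?b = "\<lambda>j. borel_of (X j)"
  interpret M: prob_space M by (rule prob_space_M)
  show "finite {1..n}" by simp
  show "sets \<pi> = sets (PiM {1..n} ?b)"
    using sets_\<pi> by (simp add: full_space_def)
  show "sets (M \<bind> (\<lambda>y. distr (\<kappa> y) F (\<lambda>u. y(i := u)))) = sets (PiM {1..n} ?b)"
    by (subst sets_bind[where N=F]) (simp_all add: full_space_def M.not_empty)
  show "range (\<lambda>_::nat. space F) \<subseteq> prod_algebra {1..n} ?b"
    using prod_algebraI_finite[of "{1..n}" "\<lambda>j. space (?b j)" ?b] by (auto simp: full_space_def space_PiM)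
  show "(\<Union>_::nat. space F) = space (PiM {1..n} ?b)" by (simp add: full_space_def)
  show "emeasure \<pi> (space F) \<noteq> \<infinity>" for j :: nat by simp
  fix A assume A: "\<And>j. j \<in> {1..n} \<Longrightarrow> A j \<in> sets (?b j)"
  let ?A = "Pi\<^sub>E {1..n} A" and ?A' = "Pi\<^sub>E ({1..n} - {i}) A"
  have A'[measurable]: "?A' \<in> sets D"
    unfolding space_drop_def using A by (intro sets_PiM_I_finite) auto
  have As: "?A \<in> sets F"
    unfolding full_space_def using A by (intro sets_PiM_I_finite) auto
  have "?A = {x \<in> space \<pi>. x i \<in> A i \<and> drop_coord n i x \<in> ?A'}"
  proof (intro equalityI subsetI)
    fix x assume "x \<in> ?A"
    then show "x \<in> {x \<in> space \<pi>. x i \<in> A i \<and> drop_coord n i x \<in> ?A'}"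
      using i sets.sets_into_space[OF As] by (auto simp: space_\<pi> drop_coord_def PiE_def Pi_def)
  next
    fix x assume x: "x \<in> {x \<in> space \<pi>. x i \<in> A i \<and> drop_coord n i x \<in> ?A'}"
    show "x \<in> ?A"
    proof (rule PiE_I)
      fix j assume "j \<in> {1..n}"
      then show "x j \<in> A j"
        using x by (cases "j = i") (auto simp: drop_coord_def PiE_def Pi_def)
    next
      fix j assume "j \<notin> {1..n}"
      then show "x j = undefined"
        using x by (auto simp: space_\<pi> full_space_def space_PiM PiE_def extensional_def)
    qed
  qed
  then have "emeasure \<pi> ?A = (\<integral>\<^sup>+y\<in>?A'. emeasure (\<kappa> y) (A i) \<partial>M)"
    using cond A[OF i] A' by (simp add: cond_dist_def)
  also have "\<dots> = (\<integral>\<^sup>+y. emeasure (distr (\<kappa> y) F (\<lambda>u. y(i := u))) ?A \<partial>M)"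
  proof (rule nn_integral_cong)
    fix y assume "y \<in> space M"
    then have y: "y \<in> space D" by (simp add: space_M)
    have ext: "y j = undefined" if "j \<notin> {1..n} - {i}" for j
      using y that by (auto simp: space_drop_def space_PiM PiE_def extensional_def)
    have upd_iff: "y(i := u) \<in> ?A \<longleftrightarrow> u \<in> A i \<and> y \<in> ?A'" for u
    proof
      assume h: "y(i := u) \<in> ?A"
      have "y \<in> ?A'"
      proof (rule PiE_I)
        show "y j \<in> A j" if "j \<in> {1..n} - {i}" for j
          using PiE_mem[OF h, of j] that by simp
      qed (rule ext)
      then show "u \<in> A i \<and> y \<in> ?A'" using PiE_mem[OF h i] by simp
    next
      assume h: "u \<in> A i \<and> y \<in> ?A'"
      show "y(i := u) \<in> ?A"
      proof (rule PiE_I)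
        show "(y(i := u)) j \<in> A j" if "j \<in> {1..n}" for j
          using h that PiE_mem[of y "{1..n} - {i}" A j] by (cases "j = i") simp_all
        show "(y(i := u)) j = undefined" if "j \<notin> {1..n}" for j
          using i that ext[of j] by (cases "j = i") simp_all
      qed
    qed
    have "A i \<subseteq> space (\<kappa> y)"
      using sets.sets_into_space[OF A[OF i]] sets_eq_imp_space_eq[OF sets_\<kappa>[OF y]] by simp
    \<comment> \<open>The fiber over y meets the box in all of \<open>A i\<close> or not at all,
      according to whether y lies in the base box; this produces the indicator.\<close>
    then have pre: "(\<lambda>u. y(i := u)) -` ?A \<inter> space (\<kappa> y) = (if y \<in> ?A' then A i else {})"
      unfolding set_eq_iff vimage_eq Int_iff upd_iff by auto
    show "emeasure (\<kappa> y) (A i) * indicator ?A' y = emeasure (distr (\<kappa> y) F (\<lambda>u. y(i := u))) ?A"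
      unfolding emeasure_distr[OF upd_section_measurable_\<kappa>[OF y] As] pre by simp
  qed
  also have "\<dots> = emeasure (M \<bind> (\<lambda>y. distr (\<kappa> y) F (\<lambda>u. y(i := u)))) ?A"
    by (rule emeasure_bind[OF M.not_empty measurable_prob_algebraD[OF fiber_kernel] As, symmetric])
  finally show "emeasure \<pi> ?A = emeasure (M \<bind> (\<lambda>y. distr (\<kappa> y) F (\<lambda>u. y(i := u)))) ?A" .
qed

lemma nn_integral_disintegration:
  assumes h: "h \<in> borel_measurable F"
  shows "(\<integral>\<^sup>+x. h x \<partial>\<pi>) = (\<integral>\<^sup>+y. \<integral>\<^sup>+u. h (y(i := u)) \<partial>\<kappa> y \<partial>M)"
proof -
  have "(\<integral>\<^sup>+x. h x \<partial>\<pi>) = (\<integral>\<^sup>+y. \<integral>\<^sup>+x. h x \<partial>distr (\<kappa> y) F (\<lambda>u. y(i := u)) \<partial>M)"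
    by (subst disintegration) (rule nn_integral_bind[OF h measurable_prob_algebraD[OF fiber_kernel]])
  also have "\<dots> = (\<integral>\<^sup>+y. \<integral>\<^sup>+u. h (y(i := u)) \<partial>\<kappa> y \<partial>M)"
    using h by (intro nn_integral_cong nn_integral_distr upd_section_measurable_\<kappa>) (auto simp: space_M)
  finally show ?thesis .
qed

text \<open>The squared norms of the sections integrate over y to \<parallel>f\<parallel>^2, which
  is finite, so almost all of them are finite.\<close>

lemma AE_section_L2:
  assumes f: "f \<in> L2 \<pi>"
  shows "AE y in M. (\<lambda>u. f (y(i := u))) \<in> L2 (\<kappa> y)"
proof -
  have [measurable]: "f \<in> borel_measurable F" and f2: "integrable \<pi> (\<lambda>x. (f x)\<^sup>2)"
    using f sets_\<pi> by (auto simp: L2_def cong: measurable_cong_sets)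
  have meas: "(\<lambda>y. \<integral>\<^sup>+u. ennreal ((f (y(i := u)))\<^sup>2) \<partial>\<kappa> y) \<in> borel_measurable D"
    by (rule nn_integral_measurable_subprob_algebra2[where N=B]) measurable
  have "(\<integral>\<^sup>+y. \<integral>\<^sup>+u. ennreal ((f (y(i := u)))\<^sup>2) \<partial>\<kappa> y \<partial>M) \<noteq> \<infinity>"
    using f2 by (subst nn_integral_disintegration[symmetric]) (auto simp: nn_integral_eq_integral)
  then have "AE y in M. (\<integral>\<^sup>+u. ennreal ((f (y(i := u)))\<^sup>2) \<partial>\<kappa> y) \<noteq> \<infinity>"
    using meas sets_M by (intro nn_integral_PInf_AE) (simp cong: measurable_cong_sets)
  then show ?thesis
    using AE_space
  proof eventually_elim
    case (elim y)
    then have "(\<lambda>u. f (y(i := u))) \<in> borel_measurable (\<kappa> y)"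
      using measurable_compose[OF upd_section_measurable_\<kappa>, of y f borel] by (simp add: space_M)
    then show ?case
      using elim by (auto simp: L2_def less_top intro!: integrableI_nonneg)
  qed
qed

end

section \<open>Kernels that move one coordinate\<close>

definition coord_kernel :: "nat \<Rightarrow> (nat \<Rightarrow> 'a topology) \<Rightarrow> nat \<Rightarrow> ((nat \<Rightarrow> 'a) \<Rightarrow> 'a \<Rightarrow> 'a measure)
    \<Rightarrow> (nat \<Rightarrow> 'a) \<Rightarrow> (nat \<Rightarrow> 'a) measure" where
  "coord_kernel n X i R x = update_coord n X i x (R (drop_coord n i x) (x i))"

text \<open>\<open>R_markov\<close> and \<open>R_reversible\<close> concern each fiber separately.
  Only \<open>R_measurable\<close> links different fibers; it makes \<open>U\<close> a kernel on the
  whole product.\<close>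

locale coordinate_kernel = coordinate_update \<pi> n X i \<kappa>
  for \<pi> :: "(nat \<Rightarrow> 'a) measure" and n X i \<kappa> +
  fixes R :: "(nat \<Rightarrow> 'a) \<Rightarrow> 'a \<Rightarrow> 'a measure"
  assumes R_markov: "\<And>y. y \<in> space (space_drop n X i) \<Longrightarrow> markov_kernel (borel_of (X i)) (R y)"
    and R_reversible: "\<And>y. y \<in> space (space_drop n X i) \<Longrightarrow> reversible (\<kappa> y) (R y)"
    and R_measurable: "(\<lambda>x. R (drop_coord n i x) (x i)) \<in> full_space n X \<rightarrow>\<^sub>M prob_algebra (borel_of (X i))"
begin

abbreviation "U \<equiv> coord_kernel n X i R"

lemma R_subprob[measurable]: "(\<lambda>x. R (drop_coord n i x) (x i)) \<in> F \<rightarrow>\<^sub>M subprob_algebra B"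
  by (rule measurable_prob_algebraD[OF R_measurable])

lemma reversible_kernel_fiber:
  assumes y: "y \<in> space D"
  shows "reversible_kernel (\<kappa> y) (R y)"
proof (intro reversible_kernel.intro prob_space_\<kappa>[OF y] reversible_kernel_axioms.intro R_reversible[OF y])
  have "prob_algebra (\<kappa> y) = prob_algebra B"
    unfolding prob_algebra_def using subprob_algebra_cong[OF sets_\<kappa>[OF y]] by simp
  then show "markov_kernel (\<kappa> y) (R y)"
    using R_markov[OF y] sets_\<kappa>[OF y] by (simp add: markov_kernel_def cong: measurable_cong_sets)
qed

lemma U_kernel: "U \<in> F \<rightarrow>\<^sub>M prob_algebra F"
  unfolding coord_kernel_def[abs_def] update_coord_def
  by (rule measurable_distr_prob_space2[OF R_measurable upd_full_measurable])

lemma nn_integral_U: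
  assumes x: "x \<in> space F" and h: "h \<in> borel_measurable F"
  shows "(\<integral>\<^sup>+z. h z \<partial>U x) = (\<integral>\<^sup>+v. h (x(i := v)) \<partial>R (drop_coord n i x) (x i))"
  unfolding coord_kernel_def update_coord_def
proof (rule nn_integral_distr)
  show "(\<lambda>v. x(i := v)) \<in> R (drop_coord n i x) (x i) \<rightarrow>\<^sub>M F"
    using measurable_compose[OF measurable_Pair1'[OF x] upd_full_measurable] sets_kernel[OF R_subprob x]
    by (simp cong: measurable_cong_sets)
qed (use h in simp)

text \<open>At the point y(i := u) the kernel moves to y(i := u, i := v) = y(i := v), with v drawn
  from \<open>R y u\<close>. The move never leaves the fiber over y, so the double integral splits
  into one double integral per fiber.\<close>

lemma nn_integral_U_disintegration:
  assumes h: "(\<lambda>(x, z). h x z) \<in> borel_measurable (F \<Otimes>\<^sub>M F)"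
  shows "(\<integral>\<^sup>+x. \<integral>\<^sup>+z. h x z \<partial>U x \<partial>\<pi>)
    = (\<integral>\<^sup>+y. \<integral>\<^sup>+u. \<integral>\<^sup>+v. h (y(i := u)) (y(i := v)) \<partial>R y u \<partial>\<kappa> y \<partial>M)"
proof -
  note [measurable] = h
  have "(\<integral>\<^sup>+x. \<integral>\<^sup>+z. h x z \<partial>U x \<partial>\<pi>)
    = (\<integral>\<^sup>+x. \<integral>\<^sup>+v. h x (x(i := v)) \<partial>R (drop_coord n i x) (x i) \<partial>\<pi>)"
    using measurable_compose[OF measurable_Pair1' h] by (intro nn_integral_cong nn_integral_U) (auto simp: space_\<pi>)
  also have "\<dots> = (\<integral>\<^sup>+y. \<integral>\<^sup>+u. \<integral>\<^sup>+v. h (y(i := u)) (y(i := v)) \<partial>R y u \<partial>\<kappa> y \<partial>M)"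
  proof (subst nn_integral_disintegration)
    show "(\<lambda>x. \<integral>\<^sup>+v. h x (x(i := v)) \<partial>R (drop_coord n i x) (x i)) \<in> borel_measurable F"
      by (rule nn_integral_measurable_subprob_algebra2[OF _ R_subprob]) measurable
  qed (auto intro!: nn_integral_cong simp: space_M drop_upd)
  finally show ?thesis .
qed

lemma sets_U: "sets (U x) = sets F"
  by (simp add: coord_kernel_def update_coord_def)

text \<open>Over a fixed y the sets A and A' become their sections in X_i, and the inner integral is
  one side of the reversibility identity of \<open>R y\<close>.\<close>

lemma set_nn_integral_emeasure_U:
  assumes [measurable]: "A \<in> sets F" "A' \<in> sets F"
  shows "(\<integral>\<^sup>+x\<in>A. emeasure (U x) A' \<partial>\<pi>)
    = (\<integral>\<^sup>+y. (\<integral>\<^sup>+u\<in>{u \<in> space B. y(i := u) \<in> A}. emeasure (R y u) {v \<in> space B. y(i := v) \<in> A'} \<partial>\<kappa> y) \<partial>M)"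
proof -
  have "(\<integral>\<^sup>+x\<in>A. emeasure (U x) A' \<partial>\<pi>) = (\<integral>\<^sup>+x. \<integral>\<^sup>+z. indicator A x * indicator A' z \<partial>U x \<partial>\<pi>)"
    by (intro nn_integral_cong) (simp add: nn_integral_cmult_indicator sets_U mult.commute[of _ "indicator A _"])
  also have "\<dots> = (\<integral>\<^sup>+y. \<integral>\<^sup>+u. \<integral>\<^sup>+v. indicator A (y(i := u)) * indicator A' (y(i := v)) \<partial>R y u \<partial>\<kappa> y \<partial>M)"
    by (rule nn_integral_U_disintegration) measurable
  also have "\<dots> = (\<integral>\<^sup>+y. (\<integral>\<^sup>+u\<in>{u \<in> space B. y(i := u) \<in> A}. emeasure (R y u) {v \<in> space B. y(i := v) \<in> A'} \<partial>\<kappa> y) \<partial>M)"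
  proof (intro nn_integral_cong)
    fix y u assume "y \<in> space M" "u \<in> space (\<kappa> y)"
    then have y: "y \<in> space D" and u: "u \<in> space (\<kappa> y)" "u \<in> space B"
      using sets_eq_imp_space_eq[OF sets_\<kappa>] by (auto simp: space_M)
    have sR: "sets (R y u) = sets B"
      using reversible_kernel.sets_K[OF reversible_kernel_fiber[OF y] u(1)] sets_\<kappa>[OF y] by simp
    have "{v \<in> space B. y(i := v) \<in> A'} \<in> sets B"
      using measurable_sets[OF upd_section_measurable[OF y] assms(2)] by (simp add: vimage_def Int_def conj_commute)
    moreover have "(\<integral>\<^sup>+v. indicator A (y(i := u)) * indicator A' (y(i := v)) \<partial>R y u)
      = (\<integral>\<^sup>+v. indicator {u \<in> space B. y(i := u) \<in> A} u * indicator {v \<in> space B. y(i := v) \<in> A'} v \<partial>R y u)"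
      using u(2) sets_eq_imp_space_eq[OF sR] by (intro nn_integral_cong) (auto simp: indicator_def)
    ultimately show "(\<integral>\<^sup>+v. indicator A (y(i := u)) * indicator A' (y(i := v)) \<partial>R y u)
      = emeasure (R y u) {v \<in> space B. y(i := v) \<in> A'} * indicator {u \<in> space B. y(i := u) \<in> A} u"
      by (simp add: nn_integral_cmult_indicator sR mult.commute[of _ "indicator _ u"])
  qed
  finally show ?thesis .
qed

text \<open>Exchanging A and A' leaves the inner integral unchanged for every y, by reversibility of
  \<open>R y\<close> applied to the two sections.\<close>

lemma reversible_kernel_U: "reversible_kernel \<pi> U"
proof
  have "prob_algebra \<pi> = prob_algebra F"
    unfolding prob_algebra_def using subprob_algebra_cong[OF sets_\<pi>] by simp
  then show "markov_kernel \<pi> U"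
    using U_kernel sets_\<pi> by (simp add: markov_kernel_def cong: measurable_cong_sets)
  have sec: "{u \<in> space B. y(i := u) \<in> A} \<in> sets (\<kappa> y)" if "A \<in> sets F" "y \<in> space D" for A y
    using measurable_sets[OF upd_section_measurable[OF that(2)] that(1)] sets_\<kappa>[OF that(2)]
    by (simp add: vimage_def Int_def conj_commute)
  show "reversible \<pi> U"
    unfolding reversible_def sets_\<pi>
  proof (intro ballI)
    fix A A' assume A: "A \<in> sets F" "A' \<in> sets F"
    show "(\<integral>\<^sup>+x\<in>A. emeasure (U x) A' \<partial>\<pi>) = (\<integral>\<^sup>+x\<in>A'. emeasure (U x) A \<partial>\<pi>)"
      unfolding set_nn_integral_emeasure_U[OF A] set_nn_integral_emeasure_U[OF A(2,1)]
    proof (rule nn_integral_cong)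
      fix y assume "y \<in> space M"
      then have y: "y \<in> space D" by (simp add: space_M)
      show "(\<integral>\<^sup>+u\<in>{u \<in> space B. y(i := u) \<in> A}. emeasure (R y u) {v \<in> space B. y(i := v) \<in> A'} \<partial>\<kappa> y)
        = (\<integral>\<^sup>+u\<in>{u \<in> space B. y(i := u) \<in> A'}. emeasure (R y u) {v \<in> space B. y(i := v) \<in> A} \<partial>\<kappa> y)"
        using R_reversible[OF y] sec[OF A(1) y] sec[OF A(2) y] unfolding reversible_def by blast
    qed
  qed
qed

lemma energy_U:
  assumes [measurable]: "f \<in> borel_measurable F"
  shows "energy \<pi> U f = (\<integral>\<^sup>+y. energy (\<kappa> y) (R y) (\<lambda>u. f (y(i := u))) \<partial>M)"
  unfolding energy_def by (rule nn_integral_U_disintegration) measurable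

end

lemma (in coordinate_update) exact_coordinate_kernel: "coordinate_kernel \<pi> n X i \<kappa> (\<lambda>y _. \<kappa> y)"
proof
  fix y assume y: "y \<in> space D"
  show "markov_kernel (borel_of (X i)) (\<lambda>_. \<kappa> y)"
    unfolding markov_kernel_def by (rule measurable_const) (rule measurable_space[OF \<kappa>_prob y])
  show "reversible (\<kappa> y) (\<lambda>_. \<kappa> y)"
    by (rule reversible_kernel.rev[OF prob_space.reversible_kernel_const[OF prob_space_\<kappa>[OF y]]])
next
  show "(\<lambda>x. \<kappa> (drop_coord n i x)) \<in> F \<rightarrow>\<^sub>M prob_algebra B"
    by (rule measurable_compose[OF drop_measurable \<kappa>_prob])
qed

section \<open>Fiber comparison integrated over the marginal\<close>

context coordinate_kernel
begin

interpretation exact: coordinate_kernel \<pi> n X i \<kappa> "\<lambda>y _. \<kappa> y"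
  by (rule exact_coordinate_kernel)

text \<open>The constants 1 + C and 1 - C always multiply the exact energy, so its measurability in
  y is what allows them to be pulled out of the integral over \<open>M\<close>.\<close>

lemma fiber_energy_measurable:
  assumes [measurable]: "f \<in> borel_measurable F"
  shows "(\<lambda>y. energy (\<kappa> y) (\<lambda>_. \<kappa> y) (\<lambda>u. f (y(i := u)))) \<in> borel_measurable M"
proof -
  have *[measurable]: "(\<lambda>(y, u). \<integral>\<^sup>+v. ennreal ((f (y(i := u)) - f (y(i := v)))\<^sup>2) \<partial>\<kappa> y) \<in> borel_measurable (D \<Otimes>\<^sub>M B)"
    unfolding split_beta'
    by (rule nn_integral_measurable_subprob_algebra2[where N=B]) measurable
  have "(\<lambda>y. energy (\<kappa> y) (\<lambda>_. \<kappa> y) (\<lambda>u. f (y(i := u)))) \<in> borel_measurable D"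
    unfolding energy_def by (rule nn_integral_measurable_subprob_algebra2[OF * \<kappa>_subprob])
  then show ?thesis using sets_M by (simp cong: measurable_cong_sets)
qed

text \<open>Integration of \<open>energy_bounds\<close> over y. The fibers where the section is not
  square-integrable, or where the assumption on \<open>R y\<close> fails, form an
  \<open>M\<close>-null set and do not affect monotonicity of the integral.\<close>

lemma energy_U_bounds:
  assumes f: "f \<in> L2 \<pi>"
  shows "AE y in M. kernel_norm (\<kappa> y) (R y) \<le> C \<Longrightarrow> energy \<pi> U f \<le> ennreal (1 + C) * energy \<pi> exact.U f"
    and "AE y in M. kernel_norm (\<kappa> y) (R y) \<le> C \<Longrightarrow> ennreal (1 - C) * energy \<pi> exact.U f \<le> energy \<pi> U f"
    and "AE y in M. pos_semidef (\<kappa> y) (R y) \<Longrightarrow> energy \<pi> U f \<le> energy \<pi> exact.U f"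
    and "energy \<pi> exact.U f \<le> 2 * (\<integral>\<^sup>+x. ennreal ((f x)\<^sup>2) \<partial>\<pi>)"
proof -
  have fm[measurable]: "f \<in> borel_measurable F"
    using f sets_\<pi> by (auto simp: L2_def cong: measurable_cong_sets)
  note meas = fiber_energy_measurable[OF fm]
  note rk = reversible_kernel.energy_bounds[OF reversible_kernel_fiber]
  show "energy \<pi> U f \<le> ennreal (1 + C) * energy \<pi> exact.U f" if C: "AE y in M. kernel_norm (\<kappa> y) (R y) \<le> C"
    unfolding energy_U[OF fm] exact.energy_U[OF fm] nn_integral_cmult[OF meas, symmetric]
    using C AE_section_L2[OF f] AE_space
    by (intro nn_integral_mono_AE, eventually_elim)
       (auto simp: space_M intro!: order_trans[OF rk(1)] mult_right_mono ennreal_leI)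
  show "ennreal (1 - C) * energy \<pi> exact.U f \<le> energy \<pi> U f" if C: "AE y in M. kernel_norm (\<kappa> y) (R y) \<le> C"
    unfolding energy_U[OF fm] exact.energy_U[OF fm] nn_integral_cmult[OF meas, symmetric]
    using C AE_section_L2[OF f] AE_space
    by (intro nn_integral_mono_AE, eventually_elim)
       (auto simp: space_M intro!: order_trans[OF _ rk(2)] mult_right_mono ennreal_leI)
  show "energy \<pi> U f \<le> energy \<pi> exact.U f" if C: "AE y in M. pos_semidef (\<kappa> y) (R y)"
    unfolding energy_U[OF fm] exact.energy_U[OF fm]
    using C AE_section_L2[OF f] AE_space
    by (intro nn_integral_mono_AE, eventually_elim) (auto simp: space_M intro!: rk(3))
  have meas2: "(\<lambda>y. \<integral>\<^sup>+u. ennreal ((f (y(i := u)))\<^sup>2) \<partial>\<kappa> y) \<in> borel_measurable M"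
  proof -
    have "(\<lambda>y. \<integral>\<^sup>+u. ennreal ((f (y(i := u)))\<^sup>2) \<partial>\<kappa> y) \<in> borel_measurable D"
      by (rule nn_integral_measurable_subprob_algebra2[where N=B]) measurable
    then show ?thesis using sets_M by (simp cong: measurable_cong_sets)
  qed
  have "energy \<pi> exact.U f \<le> (\<integral>\<^sup>+y. 2 * (\<integral>\<^sup>+u. ennreal ((f (y(i := u)))\<^sup>2) \<partial>\<kappa> y) \<partial>M)"
    unfolding exact.energy_U[OF fm]
    using AE_section_L2[OF f] AE_space
    by (intro nn_integral_mono_AE, eventually_elim) (auto simp: space_M intro!: rk(4))
  also have "\<dots> = 2 * (\<integral>\<^sup>+x. ennreal ((f x)\<^sup>2) \<partial>\<pi>)"
    by (subst nn_integral_disintegration) (auto intro!: nn_integral_cmult meas2)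
  finally show "energy \<pi> exact.U f \<le> 2 * (\<integral>\<^sup>+x. ennreal ((f x)\<^sup>2) \<partial>\<pi>)" .
qed

end

section \<open>Comparison of norms\<close>

text \<open>Reading an inequality between \<open>ennreal\<close> values back in the reals requires a
  nonnegative right side, which the contraction bound for \<open>K\<close> provides.\<close>

lemma energy_le_imp_quadratic_form_le:
  assumes "reversible_kernel \<omega> K" "reversible_kernel \<omega> K'" "f \<in> L2 \<omega>" "0 \<le> c"
    and "energy \<omega> K' f \<le> ennreal c * energy \<omega> K f"
  shows "l2_inner \<omega> f f - l2_inner \<omega> f (kernel_op K' f) \<le> c * (l2_inner \<omega> f f - l2_inner \<omega> f (kernel_op K f))"
proof -
  have "0 \<le> l2_inner \<omega> f f - l2_inner \<omega> f (kernel_op K f)"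
    using reversible_kernel.l2_inner_kernel_op_le[OF assms(1,3)] by simp
  then have "ennreal (2 * (l2_inner \<omega> f f - l2_inner \<omega> f (kernel_op K' f)))
      \<le> ennreal (c * (2 * (l2_inner \<omega> f f - l2_inner \<omega> f (kernel_op K f))))"
    using assms by (simp add: reversible_kernel.energy_eq ennreal_mult'[symmetric])
  then show ?thesis
    using \<open>0 \<le> c\<close> \<open>0 \<le> l2_inner \<omega> f f - _\<close> by (subst (asm) ennreal_le_iff) (auto simp: algebra_simps intro: mult_left_mono)
qed

text \<open>With N = \<parallel>f\<parallel>^2 and q = <f, K f> the assumption reads 2 (N - q) \<le>
  2 N.\<close>

lemma quadratic_form_nonneg_if_energy_le:
  assumes "reversible_kernel \<omega> K" "f \<in> L2 \<omega>"
    and "energy \<omega> K f \<le> 2 * (\<integral>\<^sup>+x. ennreal ((f x)\<^sup>2) \<partial>\<omega>)"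
  shows "0 \<le> l2_inner \<omega> f (kernel_op K f)"
proof -
  have "2 * (\<integral>\<^sup>+x. ennreal ((f x)\<^sup>2) \<partial>\<omega>) = ennreal (2 * l2_inner \<omega> f f)"
    using assms(2) by (simp add: L2_def l2_inner_def nn_integral_eq_integral power2_eq_square ennreal_mult')
  then have "ennreal (2 * (l2_inner \<omega> f f - l2_inner \<omega> f (kernel_op K f))) \<le> ennreal (2 * l2_inner \<omega> f f)"
    using assms(3) by (simp add: reversible_kernel.energy_eq[OF assms(1,2)])
  then show ?thesis
    using l2_inner_self_nonneg[of \<omega> f] by (subst (asm) ennreal_le_iff) auto
qed

text \<open>Write N, q, q' for \<parallel>f\<parallel>^2 and the forms of \<open>K\<close> and
  \<open>K'\<close>, and h for the norm of \<open>K'\<close>. Then (1 - h) N \<le> N - q' \<le> c (N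
  - q), which bounds q from above; q \<ge> 0 makes this a bound on |q|. The constant c is 1 + C in
  general and 1 in the positive semi-definite case.\<close>

lemma gap_le:
  assumes K: "reversible_kernel \<omega> K" and K': "reversible_kernel \<omega> K'" and c: "1 \<le> c"
    and le: "\<And>f. f \<in> L2 \<omega> \<Longrightarrow> energy \<omega> K' f \<le> ennreal c * energy \<omega> K f"
    and pos: "\<And>f. f \<in> L2 \<omega> \<Longrightarrow> energy \<omega> K f \<le> 2 * (\<integral>\<^sup>+x. ennreal ((f x)\<^sup>2) \<partial>\<omega>)"
  shows "1 - kernel_norm \<omega> K' \<le> c * (1 - kernel_norm \<omega> K)"
proof -
  let ?h = "kernel_norm \<omega> K'"
  have h: "0 \<le> ?h" by (rule reversible_kernel.kernel_norm_bounds(1)[OF K'])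
  have "kernel_norm \<omega> K \<le> 1 - (1 - ?h) / c"
  proof (rule reversible_kernel.kernel_norm_le[OF K])
    \<comment> \<open>Here \<open>1 \<le> c\<close> enters: 1 - h \<le> 1 \<le> c.\<close>
    show "0 \<le> 1 - (1 - ?h) / c" using c h by (simp add: field_simps)
    fix f assume f: "f \<in> L2_0 \<omega>"
    then have f': "f \<in> L2 \<omega>" by (simp add: L2_0_def)
    let ?N = "l2_inner \<omega> f f" and ?q = "l2_inner \<omega> f (kernel_op K f)" and ?q' = "l2_inner \<omega> f (kernel_op K' f)"
    have "0 \<le> ?q" by (rule quadratic_form_nonneg_if_energy_le[OF K f' pos[OF f']])
    moreover have "?N - ?q' \<le> c * (?N - ?q)"
      using c by (intro energy_le_imp_quadratic_form_le[OF K K' f'] le f') simp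
    moreover have "?q' \<le> ?h * ?N"
      using reversible_kernel.quadratic_form_le_kernel_norm[OF K' f] by simp
    ultimately have "(1 - ?h) * ?N \<le> c * (?N - ?q)" "0 \<le> ?q"
      by (auto simp: algebra_simps)
    then show "\<bar>?q\<bar> \<le> (1 - (1 - ?h) / c) * ?N"
      using c by (simp add: field_simps)
  qed
  then show ?thesis using c by (simp add: field_simps)
qed

text \<open>The target C + (1 - C) t, with t the norm of \<open>K\<close>, is the number whose
  distance from 1 is (1 - C) (1 - t). The form of \<open>K'\<close> has to be bounded on both sides,
  since it may be negative.\<close>

lemma gap_ge:
  assumes K: "reversible_kernel \<omega> K" and K': "reversible_kernel \<omega> K'" and C: "0 \<le> C" "C \<le> 1"
    and le: "\<And>f. f \<in> L2 \<omega> \<Longrightarrow> energy \<omega> K' f \<le> ennreal (1 + C) * energy \<omega> K f"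
    and ge: "\<And>f. f \<in> L2 \<omega> \<Longrightarrow> ennreal (1 - C) * energy \<omega> K f \<le> energy \<omega> K' f"
    and pos: "\<And>f. f \<in> L2 \<omega> \<Longrightarrow> energy \<omega> K f \<le> 2 * (\<integral>\<^sup>+x. ennreal ((f x)\<^sup>2) \<partial>\<omega>)"
  shows "(1 - C) * (1 - kernel_norm \<omega> K) \<le> 1 - kernel_norm \<omega> K'"
proof -
  let ?t = "kernel_norm \<omega> K"
  have t: "0 \<le> ?t" by (rule reversible_kernel.kernel_norm_bounds(1)[OF K])
  have "kernel_norm \<omega> K' \<le> C + (1 - C) * ?t"
  proof (rule reversible_kernel.kernel_norm_le[OF K'])
    show "0 \<le> C + (1 - C) * ?t" using C t by simp
    fix f assume f: "f \<in> L2_0 \<omega>"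
    then have f': "f \<in> L2 \<omega>" by (simp add: L2_0_def)
    let ?N = "l2_inner \<omega> f f" and ?q = "l2_inner \<omega> f (kernel_op K f)" and ?q' = "l2_inner \<omega> f (kernel_op K' f)"
    have N: "0 \<le> ?N" by (rule l2_inner_self_nonneg)
    have q: "0 \<le> ?q" by (rule quadratic_form_nonneg_if_energy_le[OF K f' pos[OF f']])
    \<comment> \<open>Lower side: this rearranges to -q' \<le> C N - (1 + C) q, and q \<ge> 0 leaves
      at most C N, which is below the target.\<close>
    have "?N - ?q' \<le> (1 + C) * (?N - ?q)"
      using C by (intro energy_le_imp_quadratic_form_le[OF K K' f'] le f') simp
    then have "- ?q' \<le> C * ?N - (1 + C) * ?q" by (simp add: algebra_simps)
    moreover have "0 \<le> (1 + C) * ?q" "0 \<le> (1 - C) * ?t * ?N" using C q t N by simp_all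
    ultimately have lower: "- ?q' \<le> (C + (1 - C) * ?t) * ?N" by (simp add: algebra_simps)
    have "0 \<le> ?N - ?q'"
      using reversible_kernel.l2_inner_kernel_op_le[OF K' f'] by simp
    \<comment> \<open>Upper side: the lower comparison gives q' \<le> C N + (1 - C) q, and q \<le> t
      N yields the target.\<close>
    moreover have "ennreal ((1 - C) * (2 * (?N - ?q))) \<le> ennreal (2 * (?N - ?q'))"
      using ge[OF f'] C reversible_kernel.energy_eq[OF K f'] reversible_kernel.energy_eq[OF K' f']
      by (simp add: ennreal_mult')
    ultimately have "(1 - C) * (2 * (?N - ?q)) \<le> 2 * (?N - ?q')"
      by (subst (asm) ennreal_le_iff) auto
    moreover have "(1 - C) * ?q \<le> (1 - C) * (?t * ?N)"
      using C reversible_kernel.quadratic_form_le_kernel_norm[OF K f] by (intro mult_left_mono) auto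
    ultimately have "?q' \<le> (C + (1 - C) * ?t) * ?N" by (simp add: algebra_simps)
    with lower show "\<bar>?q'\<bar> \<le> (C + (1 - C) * ?t) * ?N" by linarith
  qed
  then show ?thesis by (simp add: algebra_simps)
qed

section \<open>Assembly for the exact and hybrid Gibbs kernels\<close>

lemma random_scan_mixture:
  assumes "prob_space \<pi>" and sets_\<pi>: "sets \<pi> = sets (full_space n X)"
    and "\<And>i. i \<in> {1..n} \<Longrightarrow> 0 \<le> p i" "(\<Sum>i=1..n. p i) = 1"
    and "\<And>i. i \<in> {1..n} \<Longrightarrow> reversible_kernel \<pi> (coord_kernel n X i (R i))"
  shows "reversible_mixture \<pi> {1..n} p (\<lambda>i. coord_kernel n X i (R i)) (random_scan n X p R)"
  using assms
  by (intro reversible_mixture.intro reversible_mixture_axioms.intro)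
     (simp_all add: emeasure_random_scan coord_kernel_def)

theorem corollary4:
  fixes n :: nat
    and X :: "nat \<Rightarrow> 'a topology"
    and \<pi> :: "(nat \<Rightarrow> 'a) measure"
    and \<pi>c :: "nat \<Rightarrow> (nat \<Rightarrow> 'a) \<Rightarrow> 'a measure"
    and Q :: "nat \<Rightarrow> (nat \<Rightarrow> 'a) \<Rightarrow> 'a \<Rightarrow> 'a measure"
    and p :: "nat \<Rightarrow> real"
    and C :: real
  assumes "\<And>i. i \<in> {1..n} \<Longrightarrow> polish (X i)"
    and "prob_space \<pi>" and "sets \<pi> = sets (full_space n X)"
    and "\<And>i. i \<in> {1..n} \<Longrightarrow> cond_dist n X \<pi> i (\<pi>c i)"
    and "\<And>i y. i \<in> {1..n} \<Longrightarrow> y \<in> space (space_drop n X i) \<Longrightarrow> markov_kernel (borel_of (X i)) (Q i y)"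
    and "\<And>i y. i \<in> {1..n} \<Longrightarrow> y \<in> space (space_drop n X i) \<Longrightarrow> reversible (\<pi>c i y) (Q i y)"
    and "\<And>i A. i \<in> {1..n} \<Longrightarrow> A \<in> sets (borel_of (X i)) \<Longrightarrow>
           (\<lambda>x. measure (Q i (drop_coord n i x) (x i)) A) \<in> borel_measurable (full_space n X)"
    and "\<And>i. i \<in> {1..n} \<Longrightarrow> p i \<ge> 0" and "(\<Sum>i=1..n. p i) = 1"
    and "0 \<le> C" and "C \<le> 1"
    and "\<And>i. i \<in> {1..n} \<Longrightarrow> AE y in marginal_drop n X \<pi> i. kernel_norm (\<pi>c i y) (Q i y) \<le> C"
  shows "(1 - C) * (1 - kernel_norm \<pi> (exact_gibbs n X p \<pi>c)) \<le> 1 - kernel_norm \<pi> (hybrid_gibbs n X p Q)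
       \<and> 1 - kernel_norm \<pi> (hybrid_gibbs n X p Q) \<le> (1 + C) * (1 - kernel_norm \<pi> (exact_gibbs n X p \<pi>c))
       \<and> ((\<forall>i\<in>{1..n}. AE y in marginal_drop n X \<pi> i. pos_semidef (\<pi>c i y) (Q i y)) \<longrightarrow>
            1 - kernel_norm \<pi> (hybrid_gibbs n X p Q) \<le> 1 - kernel_norm \<pi> (exact_gibbs n X p \<pi>c))"
proof -
  let ?e = "\<lambda>i y _. \<pi>c i y"
  let ?T = "exact_gibbs n X p \<pi>c" and ?T' = "hybrid_gibbs n X p Q"
  let ?E = "\<lambda>i. coord_kernel n X i (?e i)" and ?H = "\<lambda>i. coord_kernel n X i (Q i)"
  have upd: "coordinate_update \<pi> n X i (\<pi>c i)" if "i \<in> {1..n}" for i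
    using that assms(2,3,4) by (intro coordinate_update.intro coordinate_update_axioms.intro) auto
  note exact = coordinate_update.exact_coordinate_kernel[OF upd]
  have hybrid: "coordinate_kernel \<pi> n X i (\<pi>c i) (Q i)" if i: "i \<in> {1..n}" for i
  proof (intro coordinate_kernel.intro upd[OF i] coordinate_kernel_axioms.intro)
    interpret coordinate_update \<pi> n X i "\<pi>c i" by (rule upd[OF i])
    show "markov_kernel B (Q i y)" "reversible (\<pi>c i y) (Q i y)" if "y \<in> space D" for y
      using assms(5,6) i that by auto
    have "Q i (drop_coord n i x) (x i) \<in> space (prob_algebra B)" if x: "x \<in> space F" for x
      using measurable_space[OF assms(5)[OF i, unfolded markov_kernel_def]]
        measurable_space[OF drop_measurable x] measurable_space[OF component_measurable x] by blast
    then have Q: "prob_space (Q i (drop_coord n i x) (x i))" "sets (Q i (drop_coord n i x) (x i)) = sets B"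
      if "x \<in> space F" for x
      using that by (auto simp: space_prob_algebra)
    show "(\<lambda>x. Q i (drop_coord n i x) (x i)) \<in> F \<rightarrow>\<^sub>M prob_algebra B"
    proof (intro measurable_prob_algebraI measurable_subprob_algebra)
      fix A assume A: "A \<in> sets B"
      \<comment> \<open>The assumption is about real-valued \<open>measure\<close>; finiteness of
        the measures turns it into measurability of \<open>emeasure\<close> set by set, which
        suffices for a kernel.\<close>
      have "(\<lambda>x. ennreal (measure (Q i (drop_coord n i x) (x i)) A)) \<in> borel_measurable F"
        using assms(7)[OF i A] by measurable
      then show "(\<lambda>x. emeasure (Q i (drop_coord n i x) (x i)) A) \<in> borel_measurable F"
        by (rule measurable_cong[THEN iffD1, rotated])
           (simp add: finite_measure.emeasure_eq_measure prob_space.finite_measure Q)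
    qed (auto simp: Q intro: prob_space_imp_subprob_space)
  qed
  note UE = coordinate_kernel.reversible_kernel_U[OF exact]
  note UH = coordinate_kernel.reversible_kernel_U[OF hybrid]
  interpret E: reversible_mixture \<pi> "{1..n}" p ?E ?T
    unfolding exact_gibbs_def by (rule random_scan_mixture) (use assms(2,3,8,9) UE in auto)
  interpret H: reversible_mixture \<pi> "{1..n}" p ?H ?T'
    unfolding hybrid_gibbs_def by (rule random_scan_mixture) (use assms(2,3,8,9) UH in auto)
  note bounds = coordinate_kernel.energy_U_bounds[OF hybrid]
  have meas: "f \<in> borel_measurable \<pi>" if "f \<in> L2 \<pi>" for f using that by (simp add: L2_def)
  \<comment> \<open>Kept general in c, since it serves both for 1 + C and, in the positive
    semi-definite case, for 1.\<close>
  have upper: "energy \<pi> ?T' f \<le> ennreal c * energy \<pi> ?T f"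
    if f: "f \<in> L2 \<pi>" and le: "\<And>i. i \<in> {1..n} \<Longrightarrow> energy \<pi> (?H i) f \<le> ennreal c * energy \<pi> (?E i) f" for f c
    unfolding E.energy_mixture[OF meas[OF f]] H.energy_mixture[OF meas[OF f]] sum_distrib_left
    using mult_left_mono[OF le, of _ "ennreal (p _)"] by (intro sum_mono) (simp add: mult.left_commute)
  have le: "energy \<pi> ?T' f \<le> ennreal (1 + C) * energy \<pi> ?T f" if f: "f \<in> L2 \<pi>" for f
    using bounds(1)[OF _ f assms(12)] by (intro upper f)
  have ge: "ennreal (1 - C) * energy \<pi> ?T f \<le> energy \<pi> ?T' f" if f: "f \<in> L2 \<pi>" for f
    unfolding E.energy_mixture[OF meas[OF f]] H.energy_mixture[OF meas[OF f]] sum_distrib_left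
    using mult_left_mono[OF bounds(2)[OF _ f assms(12)], of _ "ennreal (p _)"]
    by (intro sum_mono) (simp add: mult.left_commute)
  have pos: "energy \<pi> ?T f \<le> 2 * (\<integral>\<^sup>+x. ennreal ((f x)\<^sup>2) \<partial>\<pi>)" if f: "f \<in> L2 \<pi>" for f
  proof -
    have "energy \<pi> ?T f \<le> (\<Sum>i=1..n. ennreal (p i) * (2 * (\<integral>\<^sup>+x. ennreal ((f x)\<^sup>2) \<partial>\<pi>)))"
      unfolding E.energy_mixture[OF meas[OF f]]
      using bounds(4)[OF _ f] by (intro sum_mono mult_left_mono) auto
    also have "\<dots> = 2 * (\<integral>\<^sup>+x. ennreal ((f x)\<^sup>2) \<partial>\<pi>)"
      unfolding sum_distrib_right[symmetric] E.sum_ennreal_p by simp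
    finally show ?thesis .
  qed
  note rk = E.reversible_kernel_axioms H.reversible_kernel_axioms
  have "1 - kernel_norm \<pi> ?T' \<le> 1 - kernel_norm \<pi> ?T"
    if psd: "\<forall>i\<in>{1..n}. AE y in marginal_drop n X \<pi> i. pos_semidef (\<pi>c i y) (Q i y)"
  proof -
    have "energy \<pi> ?T' f \<le> ennreal 1 * energy \<pi> ?T f" if f: "f \<in> L2 \<pi>" for f
      using bounds(3)[OF _ f] psd by (intro upper f) simp
    from gap_le[OF _ _ _ this pos] rk show ?thesis by simp
  qed
  then show ?thesis
    using gap_ge[OF E.reversible_kernel_axioms H.reversible_kernel_axioms assms(10,11) le ge pos]
      gap_le[OF E.reversible_kernel_axioms H.reversible_kernel_axioms _ le pos] assms(10) by simp
qed

end
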